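(* Let $\Gamma$ be a Jordan curve on the torus $T^2$ with type $(p,q)\in\mathbb{Z}^2\setminus\{0\}$. Let $Z\colon T^2\to T(T^2)$ be a nonzero constant vector field. Then there exist a Jordan curve $\Gamma_0$ on $T^2$ such that $\Gamma\cap\Gamma_0=\emptyset$, a domain $D\subset\mathbb{R}^2$ and a diffeomorphism $\varphi\colon T^2\setminus\Gamma_0\to D$ such that $$\operatorname{ind}_{\varphi\circ\Gamma}(d\varphi\circ Z\circ\varphi^{-1}) = 1.$$
   Context: The torus is $T^2=S^1\times S^1$, identified with the square $[0,2\pi]^2$ with opposite sides identified, i.e. with $\mathbb{R}^2/(2\pi\mathbb{Z})^2$. $T(M)$ denotes the tangent bundle of a manifold $M$. A constant vector field on $T^2$ is one of the form $a\,\frac{\partial}{\partial u}+b\,\frac{\partial}{\partial v}$ with $a,b\in\mathbb{R}$ constants, where $(u,v)$ are the coordinates induced from $\mathbb{R}^2$. A Jordan curve is a smooth injective closed curve, parametrized on $[0,2\pi]$ (injective apart from the coincidence of the endpoints), and is sometimes identified with its image. The type $(p,q)$ of a Jordan curve on $T^2$ is the pair of numbers of laps around each circumference $S^1$, i.e. its class in $\pi_1(T^2)\cong\mathbb{Z}^2$. A domain is a bounded and connected region delimited by Jordan curves. All functions and vector fields are assumed to be sufficiently differentiable. Index: for a vector field $X$ on a plane domain $D$ and a Jordan curve $\Gamma\colon[0,2\pi]\to D$ along which $X$ does not vanish, let $X_\Gamma$ be the restriction of $X$ to $\Gamma$ and let $\delta(X_\Gamma)$ be the (total, continuously measured) change of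 angle from the vector $X_\Gamma(0)$ to the vector $X_\Gamma(2\pi)$. The index of $X$ along $\Gamma$ is $$\operatorname{ind}_\Gamma(X)=\frac{1}{2\pi}\,\delta(X_\Gamma)=\frac{1}{2\pi}\int_0^{2\pi}\frac{\det\big(X|_\Gamma,(X|_\Gamma)'\big)}{\|X|_\Gamma\|^2}\,dt.$$ *)

theory Defs
  imports "HOL-Analysis.Analysis"
begin

(* C^k and C^infinity maps on an open set S, via iterated directional derivatives. *)
primrec Ck_on :: "nat \<Rightarrow> 'a::real_normed_vector set \<Rightarrow> ('a \<Rightarrow> 'b::real_normed_vector) \<Rightarrow> bool" where
  "Ck_on 0 S f \<longleftrightarrow> continuous_on S f"
| "Ck_on (Suc k) S f \<longleftrightarrow>
     (\<forall>x\<in>S. f differentiable (at x)) \<and> (\<forall>v. Ck_on k S (\<lambda>x. frechet_derivative f (at x) v))"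

definition smooth_on :: "'a::real_normed_vector set \<Rightarrow> ('a \<Rightarrow> 'b::real_normed_vector) \<Rightarrow> bool" where
  "smooth_on S f \<longleftrightarrow> (\<forall>k. Ck_on k S f)"

(* The torus S^1 x S^1 is embedded in \<complex> x \<complex>. The map torus_pt is the universal covering
   from R^2; it identifies the torus with R^2/(2 pi Z)^2, and its local inverses are the
   coordinates (u, v). Since the torus is an embedded submanifold, a map into it is smooth
   iff it is smooth as a map into the ambient space. *)
definition torus :: "(complex \<times> complex) set" where
  "torus = sphere 0 1 \<times> sphere 0 1"

definition torus_pt :: "real^2 \<Rightarrow> complex \<times> complex" where
  "torus_pt p = (cis (p $ 1), cis (p $ 2))"

(* Smooth closed curves are smooth on the whole circle, that is, also where the parameter
   interval [0, 2 pi] closes up; they are given here by their 2 pi-periodic extensions. *)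
definition jordan_curve :: "(real \<Rightarrow> 'a::real_normed_vector) \<Rightarrow> bool" where
  "jordan_curve \<Gamma> \<longleftrightarrow>
     smooth_on UNIV \<Gamma> \<and> (\<forall>t. \<Gamma> (t + 2 * pi) = \<Gamma> t) \<and> inj_on \<Gamma> {0..<2 * pi}"

definition curve_image :: "(real \<Rightarrow> 'a) \<Rightarrow> 'a set" where
  "curve_image \<Gamma> = \<Gamma> ` {0..2 * pi}"

definition torus_jordan_curve :: "(real \<Rightarrow> complex \<times> complex) \<Rightarrow> bool" where
  "torus_jordan_curve \<Gamma> \<longleftrightarrow> jordan_curve \<Gamma> \<and> curve_image \<Gamma> \<subseteq> torus"

(* The class of a closed curve under the standard isomorphism from the fundamental group of
   the torus to Z^2, which reads off the displacement of a lift to R^2. *)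
definition has_type :: "(real \<Rightarrow> complex \<times> complex) \<Rightarrow> int \<Rightarrow> int \<Rightarrow> bool" where
  "has_type \<Gamma> p q \<longleftrightarrow>
     (\<exists>\<gamma>. continuous_on {0..2 * pi} \<gamma> \<and> (\<forall>t\<in>{0..2 * pi}. torus_pt (\<gamma> t) = \<Gamma> t) \<and>
          \<gamma> (2 * pi) - \<gamma> 0 = (2 * pi) *\<^sub>R vector [of_int p, of_int q])"

definition jordan_domain :: "(real^2) set \<Rightarrow> bool" where
  "jordan_domain D \<longleftrightarrow>
     D \<noteq> {} \<and> open D \<and> connected D \<and> bounded D \<and>
     (\<exists>\<C>. finite \<C> \<and> (\<forall>C\<in>\<C>. \<exists>c. jordan_curve c \<and> C = curve_image c) \<and>
          pairwise disjnt \<C> \<and> frontier D = \<Union>\<C>)"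

(* Used for relatively open subsets M of the torus. A map on M is smooth iff it is smooth in the
   coordinates (u, v), i.e. after composition with the local diffeomorphism torus_pt. *)
definition torus_diffeo :: "(complex \<times> complex) set \<Rightarrow> (real^2) set \<Rightarrow> (complex \<times> complex \<Rightarrow> real^2) \<Rightarrow> bool" where
  "torus_diffeo M D \<phi> \<longleftrightarrow>
     bij_betw \<phi> M D \<and> smooth_on (torus_pt -` M) (\<phi> \<circ> torus_pt) \<and> smooth_on D (the_inv_into M \<phi>)"

(* The tangent bundle of the torus is trivialised by the global frame d/du, d/dv: a tangent
   vector at a point is given by its two components, and a vector field by the function that
   assigns to each point these components. *)
definition constant_field :: "real \<Rightarrow> real \<Rightarrow> complex \<times> complex \<Rightarrow> real^2" where
  "constant_field a b = (\<lambda>x. vector [a, b])"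

(* The differential of \<phi> at x, computed in the coordinates (u, v). The choice of the
   coordinates of x is irrelevant, see torus_differential_eq below. *)
definition torus_differential :: "(complex \<times> complex \<Rightarrow> real^2) \<Rightarrow> complex \<times> complex \<Rightarrow> real^2 \<Rightarrow> real^2" where
  "torus_differential \<phi> x w = frechet_derivative (\<phi> \<circ> torus_pt) (at (SOME p. torus_pt p = x)) w"

definition push_field ::
  "(complex \<times> complex) set \<Rightarrow> (complex \<times> complex \<Rightarrow> real^2) \<Rightarrow> (complex \<times> complex \<Rightarrow> real^2) \<Rightarrow> real^2 \<Rightarrow> real^2" where
  "push_field M \<phi> Z y =
     (let x = the_inv_into M \<phi> y in torus_differential \<phi> x (Z x))"

definition field_index :: "(real^2 \<Rightarrow> real^2) \<Rightarrow> (real \<Rightarrow> real^2) \<Rightarrow> real" where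
  "field_index X \<Gamma> = 1 / (2 * pi) *
     integral {0..2 * pi} (\<lambda>t.
       det (vector [X (\<Gamma> t), vector_derivative (\<lambda>s. X (\<Gamma> s)) (at t)] :: real^2^2)
         / (norm (X (\<Gamma> t)))\<^sup>2)"

lemma torus_differential_eq:
  assumes "(\<phi> \<circ> torus_pt) differentiable (at p)"
  shows "torus_differential \<phi> (torus_pt p) w = frechet_derivative (\<phi> \<circ> torus_pt) (at p) w"
proof -
  define q where "q = (SOME q. torus_pt q = torus_pt p)"
  have q: "torus_pt q = torus_pt p" unfolding q_def by (rule someI) simp
  have per: "torus_pt (y + (p - q)) = torus_pt y" for y
  proof -
    have "cis ((y + (p - q)) $ i) = cis (y $ i)" if "cis (q $ i) = cis (p $ i)" for i
      using that by (simp add: cis_mult[symmetric] cis_divide[symmetric] cis_neq_zero)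
    thus ?thesis using q by (simp add: torus_pt_def)
  qed
  let ?f = "\<phi> \<circ> torus_pt" and ?D = "frechet_derivative (\<phi> \<circ> torus_pt) (at p)"
  have "(?f has_derivative ?D) (at (q + (p - q)))"
    using assms frechet_derivative_works[of ?f "at p"] by simp
  moreover have "((\<lambda>y. y + (p - q)) has_derivative (\<lambda>h. h)) (at q)"
    by (auto intro!: derivative_eq_intros)
  ultimately have "((\<lambda>y. ?f (y + (p - q))) has_derivative (\<lambda>h. ?D h)) (at q)"
    by (rule has_derivative_compose[rotated])
  hence "(?f has_derivative ?D) (at q)" by (simp add: per o_def)
  hence "?D = frechet_derivative ?f (at q)" by (rule frechet_derivative_at)
  thus ?thesis by (simp add: torus_differential_def q_def)
qed

(* The integral is the total change of angle along the curve, divided by 2 pi. *)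
lemma field_index_angle:
  fixes \<theta> :: "real \<Rightarrow> real"
  assumes diff: "\<And>t. t \<in> {0..2 * pi} \<Longrightarrow> (\<lambda>s. X (\<Gamma> s)) differentiable (at t)"
    and nz: "\<And>t. t \<in> {0..2 * pi} \<Longrightarrow> X (\<Gamma> t) \<noteq> 0"
    and cont: "continuous_on {0..2 * pi} \<theta>"
    and ang: "\<And>t. t \<in> {0..2 * pi} \<Longrightarrow> X (\<Gamma> t) = norm (X (\<Gamma> t)) *\<^sub>R vector [cos (\<theta> t), sin (\<theta> t)]"
  shows "field_index X \<Gamma> = (\<theta> (2 * pi) - \<theta> 0) / (2 * pi)"
proof -
  define W where "W = (\<lambda>s. X (\<Gamma> s))"
  define W' where "W' = (\<lambda>t. vector_derivative W (at t))"
  define w where "w = (\<lambda>t. Complex (W t $ 1) (W t $ 2))"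
  define w' where "w' = (\<lambda>t. Complex (W' t $ 1) (W' t $ 2))"
  let ?I = "{0..2 * pi}"
  have norm_w: "cmod (w t) = norm (W t)" for t
    by (simp add: w_def cmod_def norm_vec_def L2_set_def UNIV_2)
  have w_polar: "w t = of_real (cmod (w t)) * cis (\<theta> t)" if "t \<in> ?I" for t
    using arg_cong[OF ang[OF that], of "\<lambda>v. Complex (v $ 1) (v $ 2)"]
    by (simp add: norm_w) (simp add: w_def W_def complex_eq_iff)
  have w_nz: "w t \<noteq> 0" if "t \<in> ?I" for t
    using nz[OF that] norm_w[of t] by (auto simp: W_def)
  have der_w: "(w has_vector_derivative w' t) (at t)" if "t \<in> ?I" for t
  proof -
    have "(W has_vector_derivative W' t) (at t)"
      using diff[OF that] by (simp add: W_def W'_def vector_derivative_works)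
    hence "((\<lambda>s. W s $ i) has_vector_derivative W' t $ i) (at t)" for i
      by (rule bounded_linear.has_vector_derivative[OF bounded_linear_vec_nth])
    hence "((\<lambda>s. W s $ i) has_real_derivative W' t $ i) (at t)" for i
      by (simp add: has_real_derivative_iff_has_vector_derivative)
    thus ?thesis
      unfolding w_def w'_def has_vector_derivative_complex_iff by simp
  qed
  have integrand: "det (vector [W t, W' t] :: real^2^2) / (norm (W t))\<^sup>2 = Im (w' t / w t)" for t
    by (simp add: det_2 norm_w[symmetric] Im_divide cmod_power2)
       (simp add: w_def w'_def algebra_simps)
  have "(\<theta> has_vector_derivative Im (w' t / w t)) (at t within ?I)" if t: "t \<in> ?I" for t
  proof -
    let ?h = "\<lambda>s. \<theta> t + Im (Ln (w s / w t))"
    have "((\<lambda>s. w s / w t) has_vector_derivative w' t / w t) (at t within ?I)"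
      using has_vector_derivative_divide[OF has_vector_derivative_at_within[OF der_w[OF t]]] .
    moreover have "(Ln has_field_derivative 1) (at (w t / w t))"
      using has_field_derivative_Ln[of 1] w_nz[OF t] by simp
    ultimately have "((Ln \<circ> (\<lambda>s. w s / w t)) has_vector_derivative (w' t / w t) * 1) (at t within ?I)"
      by (intro field_vector_diff_chain_within) (auto intro: has_field_derivative_at_within)
    hence "((\<lambda>s. Im (Ln (w s / w t))) has_vector_derivative Im (w' t / w t)) (at t within ?I)"
      using bounded_linear.has_vector_derivative[OF bounded_linear_Im] by (fastforce simp: o_def)
    hence h: "(?h has_vector_derivative Im (w' t / w t)) (at t within ?I)"
      by (auto intro!: derivative_eq_intros)
    obtain d where d: "d > 0" "\<And>s. s \<in> ?I \<Longrightarrow> dist s t < d \<Longrightarrow> dist (\<theta> s) (\<theta> t) < pi"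
      using cont t pi_gt_zero unfolding continuous_on_iff by metis
    have eq: "?h s = \<theta> s" if s: "s \<in> ?I" "dist s t < d" for s
    proof -
      let ?r = "cmod (w s) / cmod (w t)"
      have "w s / w t = of_real ?r * cis (\<theta> s - \<theta> t)"
        by (subst (1) w_polar[OF s(1)], subst (1) w_polar[OF t]) (simp add: cis_divide[symmetric])
      also have "\<dots> = exp (Complex (ln ?r) (\<theta> s - \<theta> t))"
        using w_nz[OF s(1)] w_nz[OF t] by (simp add: exp_eq_polar exp_of_real)
      finally have "Ln (w s / w t) = Complex (ln ?r) (\<theta> s - \<theta> t)"
        using d(2)[OF s] by (simp add: dist_real_def abs_less_iff)
      thus ?thesis by simp
    qed
    show ?thesis
      using has_vector_derivative_transform_within[OF h d(1) t eq] by blast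
  qed
  hence "((\<lambda>t. Im (w' t / w t)) has_integral (\<theta> (2 * pi) - \<theta> 0)) ?I"
    by (intro fundamental_theorem_of_calculus) auto
  hence "integral ?I (\<lambda>t. det (vector [W t, W' t] :: real^2^2) / (norm (W t))\<^sup>2) = \<theta> (2 * pi) - \<theta> 0"
    unfolding integrand by (rule integral_unique)
  thus ?thesis by (simp add: field_index_def W_def W'_def)
qed

end

theory Submission
  imports Defs "HOL-Complex_Analysis.Riemann_Mapping"
begin

text \<open>Let \<open>(p, q) = d (p', q')\<close> with \<open>(p', q')\<close> primitive and \<open>d > 0\<close>. The map \<open>E w = exp (\<i> w / (p' + \<i> q'))\<close>
  presents the torus as the quotient of the punctured plane by \<open>z \<mapsto> \<mu> z\<close> for some \<open>\<bar>\<mu>\<bar> > 1\<close>, and \<open>\<Gamma>\<close> lifts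
  to a Jordan curve \<open>K\<close> with winding number \<open>d\<close> about \<open>0\<close>; hence \<open>d = 1\<close>. As \<open>\<mu>\<^sup>-\<^sup>1 K\<close> lies inside \<open>K\<close>, a
  Riemann map of the inside of \<open>K\<close> sends a circle of radius close to \<open>1\<close> to a smooth Jordan curve
  \<open>K\<^sub>0\<close> that separates \<open>\<mu>\<^sup>-\<^sup>1 K\<close> from \<open>K\<close>. Its image in the torus is \<open>\<Gamma>\<^sub>0\<close>, the region \<open>D\<close> between \<open>K\<^sub>0\<close> and
  \<open>\<mu> K\<^sub>0\<close> is a copy of the cut torus, and \<open>\<phi>\<close> is a branch of \<open>E\<close>. The constant field becomes the linear
  field \<open>z \<mapsto> c z\<close> on \<open>D\<close>, whose index along \<open>K\<close> is the winding number of \<open>K\<close>.\<close>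

subsection \<open>Maps of class \<open>C\<^sup>k\<close>\<close>

lemma Ck_on_subset: "Ck_on k S f \<Longrightarrow> T \<subseteq> S \<Longrightarrow> Ck_on k T f"
  by (induction k arbitrary: f) (auto intro: continuous_on_subset)

text \<open>A derivative at a point depends only on the germ there, so at every order the function
  may be traded for a local model. This serves maps that have only local formulas, such as branches
  of a logarithm.\<close>

lemma Ck_on_locally:
  assumes "\<And>x. x \<in> S \<Longrightarrow> \<exists>U g. open U \<and> x \<in> U \<and> Ck_on k U g \<and> (\<forall>y\<in>U. f y = g y)"
  shows "Ck_on k S f"
  using assms
proof (induction k arbitrary: f)
  case 0
  have "isCont f x" if x: "x \<in> S" for x
  proof -
    obtain U g where U: "open U" "x \<in> U" "continuous_on U g" "\<forall>y\<in>U. f y = g y"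
      using 0[OF x] by auto
    then have "continuous_on U f" by (simp cong: continuous_on_cong)
    with U show ?thesis using continuous_on_eq_continuous_at by blast
  qed
  then show ?case by (simp add: continuous_at_imp_continuous_on)
next
  case (Suc k)
  have loc: "f differentiable (at y) \<and> frechet_derivative f (at y) = frechet_derivative g (at y)"
    if U: "open U" "y \<in> U" "Ck_on (Suc k) U g" "\<forall>y\<in>U. f y = g y" for U g y
  proof -
    have "(g has_derivative frechet_derivative g (at y)) (at y)"
      using U by (simp add: frechet_derivative_works)
    then have "(f has_derivative frechet_derivative g (at y)) (at y)"
      by (rule has_derivative_transform_within_open[OF _ U(1,2)]) (use U in auto)
    then show ?thesis
      using frechet_derivative_at differentiableI by metis
  qed
  show ?case
    unfolding Ck_on.simps
  proof (intro conjI ballI allI)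
    fix x assume "x \<in> S"
    then show "f differentiable (at x)" using Suc.prems loc by blast
  next
    fix v
    show "Ck_on k S (\<lambda>x. frechet_derivative f (at x) v)"
    proof (rule Suc.IH)
      fix x assume "x \<in> S"
      then obtain U g where U: "open U" "x \<in> U" "Ck_on (Suc k) U g" "\<forall>y\<in>U. f y = g y"
        using Suc.prems by blast
      then have "Ck_on k U (\<lambda>x. frechet_derivative g (at x) v)" by simp
      moreover have "\<forall>y\<in>U. frechet_derivative f (at y) v = frechet_derivative g (at y) v"
        using loc U by metis
      ultimately show "\<exists>U g. open U \<and> x \<in> U \<and> Ck_on k U g \<and>
          (\<forall>y\<in>U. frechet_derivative f (at y) v = g y)"
        using U by blast
    qed
  qed
qed

text \<open>Links \<open>Ck_on\<close>, phrased with \<open>frechet_derivative\<close>, to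
  derivative rules that yield an explicit \<open>f'\<close>; by uniqueness of derivatives both agree
  on the open set \<open>S\<close>.\<close>

lemma Ck_on_SucI:
  assumes "open S" "\<And>x. x \<in> S \<Longrightarrow> (f has_derivative f' x) (at x)" "\<And>v. Ck_on k S (\<lambda>x. f' x v)"
  shows "Ck_on (Suc k) S f"
proof -
  have "frechet_derivative f (at x) = f' x" if "x \<in> S" for x
    using frechet_derivative_at[OF assms(2)[OF that]] by simp
  then have "Ck_on k S (\<lambda>x. frechet_derivative f (at x) v)" for v
    using assms(1) assms(3)[of v] by (intro Ck_on_locally exI[of _ S] exI[of _ "\<lambda>x. f' x v"]) auto
  with assms(2) show ?thesis by (auto intro: differentiableI)
qed

lemma Ck_on_Suc_imp_has_derivative:
  "Ck_on (Suc k) S f \<Longrightarrow> x \<in> S \<Longrightarrow> (f has_derivative frechet_derivative f (at x)) (at x)"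
  by (simp add: frechet_derivative_works)

lemma Ck_on_Suc_imp_Ck_on: "Ck_on (Suc k) S f \<Longrightarrow> Ck_on k S f"
proof (induction k arbitrary: f)
  case 0
  then show ?case
    by (simp add: differentiable_imp_continuous_on differentiable_on_def differentiable_at_withinI)
next
  case (Suc k)
  then show ?case
    unfolding Ck_on.simps(2)[of k] Ck_on.simps(2)[of "Suc k"] by blast
qed

lemma Ck_on_add:
  assumes "open S" "Ck_on k S f" "Ck_on k S g"
  shows "Ck_on k S (\<lambda>x. f x + g x)"
  using assms(2,3)
proof (induction k arbitrary: f g)
  case (Suc k)
  show ?case
    by (rule Ck_on_SucI[OF assms(1) has_derivative_add
          [OF Ck_on_Suc_imp_has_derivative[OF Suc.prems(1)] Ck_on_Suc_imp_has_derivative[OF Suc.prems(2)]]])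
       (use Suc in auto)
qed (auto intro: continuous_on_add)

lemma Ck_on_bounded_linear:
  assumes "open S" "bounded_linear A" "Ck_on k S f"
  shows "Ck_on k S (\<lambda>x. A (f x))"
  using assms(3)
proof (induction k arbitrary: f)
  case 0
  then show ?case by (simp add: bounded_linear.continuous_on[OF assms(2)])
next
  case (Suc k)
  show ?case
    by (rule Ck_on_SucI[OF assms(1) bounded_linear.has_derivative[OF assms(2)
          Ck_on_Suc_imp_has_derivative[OF Suc.prems]]]) (use Suc in auto)
qed

lemma Ck_on_bounded_bilinear:
  assumes "open S" "bounded_bilinear B" "Ck_on k S f" "Ck_on k S g"
  shows "Ck_on k S (\<lambda>x. B (f x) (g x))"
  using assms(3,4)
proof (induction k arbitrary: f g)
  case 0
  then show ?case by (simp add: bounded_bilinear.continuous_on[OF assms(2)])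
next
  case (Suc k)
  \<comment> \<open>The product rule leaves one factor undifferentiated in each summand, so both
    factors are also needed one order lower.\<close>
  note lower = Suc.prems[THEN Ck_on_Suc_imp_Ck_on]
  show ?case
    by (rule Ck_on_SucI[OF assms(1) bounded_bilinear.FDERIV[OF assms(2)
          Ck_on_Suc_imp_has_derivative[OF Suc.prems(1)] Ck_on_Suc_imp_has_derivative[OF Suc.prems(2)]]])
       (use Suc lower in \<open>auto intro!: Ck_on_add[OF assms(1)]\<close>)
qed

lemma Ck_on_Pair:
  assumes "open S" "Ck_on k S f" "Ck_on k S g"
  shows "Ck_on k S (\<lambda>x. (f x, g x))"
proof -
  have "Ck_on k S (\<lambda>x. (f x, 0) + (0, g x))"
    by (intro Ck_on_add assms Ck_on_bounded_linear[OF assms(1) _ assms(2)]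
        Ck_on_bounded_linear[OF assms(1) _ assms(3)] bounded_linear_Pair
        bounded_linear_ident bounded_linear_zero)
  then show ?thesis by simp
qed

text \<open>Each directional derivative is \<open>deriv f z * L v\<close> at \<open>z = L x\<close>,
  again a holomorphic function composed with \<open>L\<close>, so the induction repeats. Taking
  \<open>of_real\<close> or \<open>to_complex\<close> for \<open>L\<close> covers curves and plane
  maps alike.\<close>

lemma Ck_on_holomorphic:
  assumes "open S" "bounded_linear L" "f holomorphic_on S"
  shows "Ck_on k (L -` S) (\<lambda>x. f (L x))"
  using assms(3)
proof (induction k arbitrary: f)
  case 0
  have "continuous_on (L -` S) L"
    using assms(2) bounded_linear.continuous_on continuous_on_id by blast
  then show ?case
    using continuous_on_compose2[OF holomorphic_on_imp_continuous_on[OF 0]] by auto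
next
  case (Suc k)
  have "open (L -` S)"
    using assms continuous_open_vimage linear_continuous_at by blast
  moreover have "((\<lambda>x. f (L x)) has_derivative (\<lambda>v. deriv f (L x) * L v)) (at x)"
    if "x \<in> L -` S" for x
  proof -
    have "(f has_derivative (*) (deriv f (L x))) (at (L x))"
      using Suc.prems assms(1) that
      by (simp add: holomorphic_derivI has_field_derivative_def[symmetric])
    from has_derivative_compose[OF bounded_linear_imp_has_derivative[OF assms(2)] this]
    show ?thesis .
  qed
  moreover have "Ck_on k (L -` S) (\<lambda>x. deriv f (L x) * L v)" for v
    using Suc.prems assms(1)
    by (intro Suc.IH[of "\<lambda>z. deriv f z * L v"]) (auto intro!: holomorphic_intros)
  ultimately show ?case by (rule Ck_on_SucI)
qed

subsection \<open>Discs and annuli bounded by Jordan curves\<close>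

text \<open>On the closed disc \<open>g\<close> is a homeomorphism onto its image. Invariance of
  domain gives openness, and a homeomorphic copy of a compact convex set does not separate the
  plane.\<close>

lemma disc_image_topology:
  fixes g :: "complex \<Rightarrow> complex"
  assumes g: "g holomorphic_on ball 0 1" "inj_on g (ball 0 1)" and r: "0 < r" "r < 1"
  shows "open (g ` ball 0 r)" "compact (g ` cball 0 r)" "connected (- g ` cball 0 r)"
    "frontier (g ` cball 0 r) = g ` sphere 0 r" "frontier (g ` ball 0 r) = g ` sphere 0 r"
    "g ` cball 0 r - g ` ball 0 r = g ` sphere 0 r"
proof -
  have sub: "cball 0 r \<subseteq> ball 0 1" "ball 0 r \<subseteq> ball 0 1"
    using r by auto
  have cont: "continuous_on (ball 0 1) g"
    by (rule holomorphic_on_imp_continuous_on[OF g(1)])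
  note contr = continuous_on_subset[OF cont sub(1)]
  show op: "open (g ` ball 0 r)"
    by (rule invariance_of_domain)
       (use continuous_on_subset[OF cont sub(2)] inj_on_subset[OF g(2) sub(2)] in auto)
  show cp: "compact (g ` cball 0 r)"
    by (rule compact_continuous_image[OF contr compact_cball])
  have "cball (0::complex) r homeomorphic g ` cball 0 r"
    using homeomorphic_compact[OF compact_cball contr refl] inj_on_subset[OF g(2) sub(1)] by blast
  then have "g ` cball 0 r homeomorphic cball (0::complex) r"
    by (rule homeomorphic_sym[THEN iffD1])
  from connected_complement_homeomorphic_convex_compact[OF this convex_cball compact_cball]
  show "connected (- g ` cball 0 r)" by simp
  show diff: "g ` cball 0 r - g ` ball 0 r = g ` sphere 0 r"
    using inj_on_image_set_diff[OF g(2), of "cball 0 r" "ball 0 r"] sub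
    unfolding cball_diff_eq_sphere[symmetric] by blast
  have "interior (g ` cball 0 r) \<subseteq> g ` ball 0 r"
  proof
    fix x assume x: "x \<in> interior (g ` cball 0 r)"
    \<comment> \<open>This set is open, and injectivity of \<open>g\<close> keeps it in the closed
      disc, hence in the open one.\<close>
    let ?V = "ball 0 1 \<inter> g -` interior (g ` cball 0 r)"
    have "open ?V"
      by (intro continuous_open_preimage[OF cont]) auto
    moreover have "?V \<subseteq> cball 0 r"
    proof
      fix z assume z: "z \<in> ?V"
      then obtain w where "w \<in> cball 0 r" "g z = g w"
        using interior_subset by blast
      then show "z \<in> cball 0 r"
        using z inj_onD[OF g(2), of z w] r by auto
    qed
    ultimately have V: "?V \<subseteq> ball 0 r"
      by (metis interior_cball interior_maximal)
    obtain z where "z \<in> cball 0 r" "x = g z"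
      using x interior_subset by blast
    with x sub(1) V show "x \<in> g ` ball 0 r"
      by blast
  qed
  then have "interior (g ` cball 0 r) = g ` ball 0 r"
    using op by (metis antisym ball_subset_cball image_mono interior_maximal)
  then show "frontier (g ` cball 0 r) = g ` sphere 0 r"
    using cp diff by (simp add: frontier_def compact_imp_closed closure_closed)
  have "closure (g ` ball 0 r) \<subseteq> g ` cball 0 r"
    by (intro closure_minimal image_mono ball_subset_cball compact_imp_closed cp)
  moreover have "g ` closure (ball 0 r) \<subseteq> closure (g ` ball 0 r)"
    using r contr by (intro continuous_image_closure_subset[of "cball 0 r"]) auto
  ultimately have "closure (g ` ball 0 r) = g ` cball 0 r"
    using r by auto
  then show "frontier (g ` ball 0 r) = g ` sphere 0 r"
    using op diff by (simp add: frontier_def interior_open)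
qed

text \<open>A point of \<open>S\<close> interior to the union has a neighbourhood avoiding the
  closed set \<open>T\<close>, so it is already interior to \<open>S\<close>; hence the interiors
  add up as the closures do.\<close>

lemma frontier_Un_disjoint_closed:
  assumes "closed S" "closed T" "S \<inter> T = {}"
  shows "frontier (S \<union> T) = frontier S \<union> frontier T"
proof -
  have "interior (S \<union> T) - T \<subseteq> interior S" "interior (S \<union> T) - S \<subseteq> interior T"
    by (rule interior_maximal; use assms interior_subset[of "S \<union> T"] in \<open>auto intro: open_Diff\<close>)+
  moreover have "interior S \<union> interior T \<subseteq> interior (S \<union> T)"
    by (simp add: interior_mono)
  ultimately have "interior (S \<union> T) = interior S \<union> interior T"
    using assms(3) interior_subset[of "S \<union> T"] by blast
  moreover have "interior S \<inter> T = {}" "interior T \<inter> S = {}"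
    using assms(3) interior_subset by blast+
  ultimately show ?thesis
    using assms by (auto simp: frontier_def closure_closed)
qed

lemma annulus_topology:
  fixes g h :: "complex \<Rightarrow> complex"
  assumes g: "g holomorphic_on ball 0 1" "inj_on g (ball 0 1)"
    and h: "h holomorphic_on ball 0 1" "inj_on h (ball 0 1)"
    and r: "0 < r" "r < 1" and sub: "g ` cball 0 r \<subseteq> h ` ball 0 r"
  defines "D \<equiv> h ` ball 0 r - g ` cball 0 r"
  shows "open D" "connected D" "bounded D" "frontier D = g ` sphere 0 r \<union> h ` sphere 0 r"
proof -
  note G = disc_image_topology[OF g r] and H = disc_image_topology[OF h r]
  show "open D"
    unfolding D_def using G(2) H(1) by (intro open_Diff) (auto intro: compact_imp_closed)
  have "h ` ball 0 r \<subseteq> h ` cball 0 r" by auto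
  then show "bounded D"
    unfolding D_def using compact_imp_bounded[OF H(2)] bounded_subset by blast
  \<comment> \<open>The complement of the annulus is a disjoint union of a compact and a closed set,
    neither of which separates points of \<open>D\<close>. By Janiszewski's theorem, with empty
    intersection, their union does not separate them either.\<close>
  have D: "D = - (g ` cball 0 r \<union> - h ` ball 0 r)"
    unfolding D_def by auto
  have cl: "closed (- h ` ball 0 r)"
    using H(1) by (simp add: closed_Compl)
  have disj: "g ` cball 0 r \<inter> - h ` ball 0 r = {}"
    using sub by auto
  have "ball 0 r \<subseteq> ball (0::complex) 1"
    using r by auto
  then have "connected (h ` ball 0 r)"
    by (intro connected_continuous_image connected_ball
        continuous_on_subset[OF holomorphic_on_imp_continuous_on[OF h(1)]])
  then have "connected_component (h ` ball 0 r) x y" if "x \<in> D" "y \<in> D" for x y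
    using that unfolding D_def connected_iff_connected_component by blast
  moreover have "connected_component (- g ` cball 0 r) x y" if "x \<in> D" "y \<in> D" for x y
    using that G(3) unfolding D_def connected_iff_connected_component by blast
  ultimately show "connected D"
    unfolding connected_iff_connected_component D
    using Janiszewski[OF G(2) cl] by (simp add: disj)
  show "frontier D = g ` sphere 0 r \<union> h ` sphere 0 r"
    unfolding D frontier_complement
    using frontier_Un_disjoint_closed[OF compact_imp_closed[OF G(2)] cl disj] G(4) H(5)
    by (simp add: frontier_complement)
qed

section \<open>Scaling a Jordan curve into its inside\<close>

lemma inside_mult_subset:
  fixes c :: complex
  assumes "c \<noteq> 0"
  shows "(*) c ` inside S \<subseteq> inside ((*) c ` S)"
proof
  fix y assume "y \<in> (*) c ` inside S"
  then obtain x where x: "y = c * x" "x \<notin> S" "bounded (connected_component_set (- S) x)"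
    unfolding inside_def by auto
  \<comment> \<open>The component of \<open>y\<close> is bounded because division by
    \<open>c\<close> carries it into the bounded component of \<open>x\<close>.\<close>
  let ?C = "connected_component_set (- (*) c ` S) y"
  have y: "y \<notin> (*) c ` S"
    using x assms by auto
  have C: "?C \<subseteq> - (*) c ` S" "y \<in> ?C"
    using connected_component_subset y by auto
  have cancel: "c * (inverse c * z) = z" for z
    using assms by (simp add: field_simps)
  have "(*) (inverse c) ` ?C \<subseteq> connected_component_set (- S) x"
  proof (rule connected_component_maximal)
    show "x \<in> (*) (inverse c) ` ?C"
      using C(2) x(1) assms by (intro image_eqI[of _ _ y]) (auto simp: field_simps)
    show "connected ((*) (inverse c) ` ?C)"
      by (intro connected_continuous_image connected_connected_component continuous_intros)
    show "(*) (inverse c) ` ?C \<subseteq> - S"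
    proof (rule image_subsetI, rule ComplI)
      fix z assume "z \<in> ?C" "inverse c * z \<in> S"
      then have "c * (inverse c * z) \<in> (*) c ` S" by blast
      then show False using C(1) \<open>z \<in> ?C\<close> unfolding cancel by blast
    qed
  qed
  then have "bounded ((*) (inverse c) ` ?C)"
    using x(3) bounded_subset by blast
  then have "bounded ((*) c ` (*) (inverse c) ` ?C)"
    by (rule bounded_linear_image[OF _ bounded_linear_mult_right])
  then have "bounded ?C"
    by (simp only: image_image cancel image_ident)
  then show "y \<in> inside ((*) c ` S)"
    using y by (simp add: inside_def)
qed

text \<open>The scaled curve is connected and misses the curve, so a single point of it inside
  suffices. The curve point nearest to \<open>0\<close> supplies one: the open disc about
  \<open>0\<close> of that radius misses the curve and so lies inside, and scaling moves the point
  into this disc.\<close>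

lemma contracted_inside_subset:
  assumes k: "simple_path k" "pathfinish k = pathstart k" "0 \<in> inside (path_image k)"
    and c: "c \<noteq> 0" "cmod c < 1" and disj: "(*) c ` path_image k \<inter> path_image k = {}"
  shows "(*) c ` (path_image k \<union> inside (path_image k)) \<subseteq> inside (path_image k)"
proof -
  note J = Jordan_inside_outside[OF k(1,2)]
  let ?K = "path_image k"
  have K: "compact ?K" "connected ?K" "?K \<noteq> {}"
    using k(1) by (auto simp: compact_simple_path_image connected_simple_path_image)
  obtain x where x: "x \<in> ?K" "\<And>y. y \<in> ?K \<Longrightarrow> cmod x \<le> cmod y"
    using continuous_attains_inf[OF K(1,3), of cmod] by (auto intro: continuous_intros)
  have "x \<noteq> 0"
    using k(3) x(1) inside_no_overlap by blast
  then have lt: "cmod (c * x) < cmod x"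
    using c by (simp add: norm_mult)
  have "c * x \<in> inside ?K"
  proof (rule ccontr)
    assume "c * x \<notin> inside ?K"
    then have "c * x \<in> ball 0 (cmod x) - inside ?K"
      using lt by auto
    moreover have "0 \<in> ball 0 (cmod x) \<inter> inside ?K"
      using k(3) \<open>x \<noteq> 0\<close> by auto
    ultimately obtain y where "y \<in> ball 0 (cmod x)" "y \<in> frontier (inside ?K)"
      using connected_Int_frontier[OF connected_ball] by blast
    then show False using J x(2)[of y] by (metis dist_0_norm linorder_not_le mem_ball)
  qed
  moreover have "connected ((*) c ` ?K)"
    by (intro connected_continuous_image K continuous_intros)
  ultimately have K': "(*) c ` ?K \<subseteq> inside ?K"
    using connected_Int_frontier[of "(*) c ` ?K" "inside ?K"] J disj x(1) by blast
  \<comment> \<open>The inside of a Jordan curve has no holes, so along with the scaled curve it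
    contains what that curve encloses.\<close>
  have "simply_connected (inside ?K)"
    by (rule simply_connected_inside_simple_path[OF k(1)])
  then have "inside ((*) c ` ?K) \<subseteq> inside ?K"
    using J K' by (intro subset_simply_connected_imp_inside_subset) auto
  with inside_mult_subset[OF c(1), of ?K] K' show ?thesis by blast
qed

text \<open>Under the Riemann map of the inside, the compact set to be enclosed becomes a compact
  subset of the unit disc, hence lies in a smaller concentric disc. The bounding curve, the image of
  a circle under the holomorphic \<open>g\<close>, is smooth although \<open>k\<close> is merely
  continuous.\<close>

lemma obtain_separating_disc:
  assumes k: "simple_path k" "pathfinish k = pathstart k" "0 \<in> inside (path_image k)"
    and c: "c \<noteq> 0" "cmod c < 1" and disj: "(*) c ` path_image k \<inter> path_image k = {}"
  obtains g r where "g holomorphic_on ball 0 1" "inj_on g (ball 0 1)" "0 < r" "r < 1"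
    "(*) c ` (path_image k \<union> inside (path_image k)) \<subseteq> g ` ball 0 r"
    "g ` cball 0 r \<subseteq> inside (path_image k)"
proof -
  note J = Jordan_inside_outside[OF k(1,2)]
  let ?U = "inside (path_image k)"
  let ?C = "(*) c ` (path_image k \<union> ?U)"
  have "bounded ?U" using J by blast
  then have "?U \<noteq> UNIV" "?U \<noteq> {}"
    using not_bounded_UNIV k(3) by auto
  moreover have "open ?U \<and> simply_connected ?U"
    using J simply_connected_inside_simple_path[OF k(1)] by blast
  ultimately obtain f g where f: "f holomorphic_on ?U" and g: "g holomorphic_on ball 0 1"
    and fg: "\<forall>z\<in>?U. f z \<in> ball 0 1 \<and> g (f z) = z" and gf: "\<forall>z\<in>ball 0 1. g z \<in> ?U \<and> f (g z) = z"
    unfolding Riemann_mapping_theorem by blast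
  have sub: "?C \<subseteq> ?U"
    by (rule contracted_inside_subset[OF assms])
  have "closure ?U = path_image k \<union> ?U"
    using J by (metis Un_commute closure_Un_frontier)
  then have "compact (path_image k \<union> ?U)"
    using J by (metis compact_closure)
  then have "compact ?C"
    by (intro compact_continuous_image continuous_intros)
  then have "compact (f ` ?C)"
    by (rule compact_continuous_image[rotated])
       (rule holomorphic_on_imp_continuous_on[OF holomorphic_on_subset[OF f sub]])
  moreover have "f ` ?C \<noteq> {}" using k(3) by auto
  ultimately obtain z where z: "z \<in> f ` ?C" "\<And>w. w \<in> f ` ?C \<Longrightarrow> cmod w \<le> cmod z"
    using continuous_attains_sup[of "f ` ?C" cmod] by (auto intro: continuous_on_norm_id)
  have "cmod z < 1" using z(1) fg sub by auto
  then obtain r where r: "cmod z < r" "r < 1" using dense by blast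
  show ?thesis
  proof
    show "inj_on g (ball 0 1)" using gf by (metis inj_onI)
    show "0 < r" using r by (meson norm_ge_zero order_le_less_trans)
    show "?C \<subseteq> g ` ball 0 r"
    proof
      fix x assume x: "x \<in> ?C"
      then have "cmod (f x) < r" using z(2)[of "f x"] r by auto
      then show "x \<in> g ` ball 0 r" using fg sub x by (intro image_eqI[of _ _ "f x"]) auto
    qed
    show "g ` cball 0 r \<subseteq> ?U" using gf r by auto
  qed (use g r in auto)
qed

subsection \<open>The torus as a quotient of the punctured plane\<close>

definition to_complex :: "real^2 \<Rightarrow> complex" where
  "to_complex v = Complex (v $ 1) (v $ 2)"

definition of_complex :: "complex \<Rightarrow> real^2" where
  "of_complex z = vector [Re z, Im z]"

lemma to_complex_of_complex [simp]: "to_complex (of_complex z) = z"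
  by (simp add: to_complex_def of_complex_def)

lemma of_complex_to_complex [simp]: "of_complex (to_complex v) = v"
  by (simp add: to_complex_def of_complex_def vec_eq_iff forall_2)

lemma to_complex_vector [simp]: "to_complex (vector [a, b]) = Complex a b"
  by (simp add: to_complex_def)

lemma bounded_linear_to_complex: "bounded_linear to_complex"
  unfolding linear_conv_bounded_linear[symmetric]
  by (rule linearI) (simp_all add: to_complex_def complex_eq_iff)

lemma bounded_linear_of_complex: "bounded_linear of_complex"
  unfolding linear_conv_bounded_linear[symmetric]
  by (rule linearI) (simp_all add: of_complex_def vec_eq_iff forall_2)

lemma of_complex_eq_iff [simp]: "of_complex z = of_complex w \<longleftrightarrow> z = w"
  by (metis to_complex_of_complex)

lemma norm_of_complex: "norm (of_complex z) = cmod z"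
  by (simp add: of_complex_def norm_vec_def L2_set_def UNIV_2 cmod_def)

lemma of_complex_image_eq: "of_complex ` A = to_complex -` A"
  by (auto intro: image_eqI[of _ _ "to_complex _"])

lemma open_to_complex_vimage: "open A \<Longrightarrow> open (to_complex -` A)"
  using continuous_open_vimage linear_continuous_at[OF bounded_linear_to_complex] by blast

lemma frontier_of_complex_image: "frontier (of_complex ` A) = of_complex ` frontier A"
proof -
  have cl: "closure (of_complex ` B) = of_complex ` closure B" for B
  proof
    have "to_complex ` closure (of_complex ` B) \<subseteq> closure (to_complex ` of_complex ` B)"
      by (rule closure_bounded_linear_image_subset[OF bounded_linear_to_complex])
    then have "of_complex ` to_complex ` closure (of_complex ` B) \<subseteq> of_complex ` closure B"
      unfolding image_image[of to_complex] by auto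
    then show "closure (of_complex ` B) \<subseteq> of_complex ` closure B"
      by (simp add: image_image)
  qed (rule closure_bounded_linear_image_subset[OF bounded_linear_of_complex])
  have "- of_complex ` A = of_complex ` (- A)"
    by (auto simp: of_complex_image_eq)
  then show ?thesis
    by (simp add: frontier_closures cl image_Int inj_def)
qed

section \<open>The universal covering in a complex coordinate\<close>

definition torus_proj :: "complex \<Rightarrow> complex \<times> complex" where
  "torus_proj w = (cis (Re w), cis (Im w))"

lemma torus_pt_eq_torus_proj: "torus_pt v = torus_proj (to_complex v)"
  by (simp add: torus_pt_def torus_proj_def to_complex_def)

lemma torus_proj_in_torus [simp]: "torus_proj w \<in> torus"
  by (simp add: torus_def torus_proj_def)

lemma torus_proj_surj:
  assumes "x \<in> torus"
  obtains w where "x = torus_proj w"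
proof -
  obtain u v where x: "x = (u, v)" by fastforce
  then have "cmod u = 1" "cmod v = 1"
    using assms by (auto simp: torus_def)
  then have "cis (Arg u) = u" "cis (Arg v) = v"
    by (metis cis_Arg div_by_1 norm_zero of_real_1 sgn_eq zero_neq_one)+
  then show thesis
    using that[of "Complex (Arg u) (Arg v)"] by (simp add: x torus_proj_def)
qed

lemma cis_eq_cis_iff: "cis s = cis t \<longleftrightarrow> (\<exists>k::int. s = t + 2 * pi * of_int k)"
  unfolding cis_conv_exp exp_eq by (simp add: complex_eq_iff mult_ac)

lemma torus_proj_eq_iff:
  "torus_proj w = torus_proj w' \<longleftrightarrow>
    (\<exists>k l::int. w = w' + of_real (2 * pi) * Complex (of_int k) (of_int l))"
  unfolding torus_proj_def prod.inject cis_eq_cis_iff by (auto simp: complex_eq_iff)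

text \<open>Since \<open>cis (Re w) = exp (\<i> w / 2) exp (\<i> (cnj w) / 2)\<close>, and similarly for the imaginary part, the
  covering is a product of holomorphic and antiholomorphic functions.\<close>
lemma Ck_on_torus_proj:
  assumes "open S" "bounded_linear L" "u holomorphic_on S"
  shows "Ck_on k (L -` S) (\<lambda>x. torus_proj (u (L x)))"
proof -
  have eq: "torus_proj w = (exp (\<i> * w / 2) * cnj (exp (- \<i> * w / 2)), exp (w / 2) * cnj (exp (- w / 2)))" for w
  proof -
    have "\<i> * of_real (Re w) = \<i> * w / 2 + cnj (- \<i> * w / 2)"
      "\<i> * of_real (Im w) = w / 2 + cnj (- w / 2)"
      by (simp_all add: complex_eq_iff)
    then show ?thesis
      unfolding torus_proj_def cis_conv_exp exp_cnj mult_exp_exp by metis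
  qed
  have op: "open (L -` S)"
    using assms continuous_open_vimage linear_continuous_at by blast
  show ?thesis
    unfolding eq
    by (intro Ck_on_Pair op Ck_on_bounded_bilinear[OF op bounded_bilinear_mult]
        Ck_on_bounded_linear[OF op bounded_linear_cnj]
        Ck_on_holomorphic[OF assms(1,2), of "\<lambda>z. exp (\<i> * u z / 2)"]
        Ck_on_holomorphic[OF assms(1,2), of "\<lambda>z. exp (- \<i> * u z / 2)"]
        Ck_on_holomorphic[OF assms(1,2), of "\<lambda>z. exp (u z / 2)"]
        Ck_on_holomorphic[OF assms(1,2), of "\<lambda>z. exp (- u z / 2)"]
        holomorphic_intros assms(3)) auto
qed

text \<open>With \<open>\<omega> = p + \<i> q\<close>, the map \<open>w \<mapsto> exp (\<i> w / \<omega>)\<close> kills the primitive lattice vector \<open>2 \<pi> \<omega>\<close>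
  and turns a complementary one into multiplication by \<open>multiplier\<close>: the torus becomes the quotient
  of the punctured plane by powers of \<open>multiplier\<close>. The sign of the determinant makes the multiplier
  expanding.\<close>

locale torus_cover =
  fixes p q m n :: int
  assumes unimodular: "p * n - q * m = -1"
begin

definition period :: complex where "period = Complex (of_int p) (of_int q)"

definition rate :: complex where "rate = \<i> / period"

definition multiplier :: complex where
  "multiplier = exp (rate * (of_real (2 * pi) * Complex (of_int m) (of_int n)))"

text \<open>The Tate uniformization. The branch of the logarithm is immaterial on nonzero points:
  another branch shifts the argument of \<open>torus_proj\<close> by an integer multiple of
  \<open>2 * pi * period\<close>, a lattice vector.\<close>

definition tate_proj :: "complex \<Rightarrow> complex \<times> complex" where
  "tate_proj z = torus_proj (Ln z / rate)"

lemma period_nonzero: "period \<noteq> 0"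
  using unimodular by (auto simp: period_def complex_eq_iff)

lemma rate_nonzero: "rate \<noteq> 0"
  using period_nonzero by (simp add: rate_def)

lemma multiplier_nonzero [simp]: "multiplier \<noteq> 0"
  by (simp add: multiplier_def)

lemma norm_multiplier: "cmod multiplier > 1"
proof -
  have un: "real_of_int q * real_of_int m - real_of_int p * real_of_int n = 1"
    using unimodular by (metis (no_types, lifting) minus_diff_eq minus_equation_iff of_int_1 of_int_diff of_int_mult)
  \<comment> \<open>The numerator is minus the determinant, hence \<open>1\<close>.\<close>
  have "Re (rate * Complex (of_int m) (of_int n)) = (q * m - p * n) / (p\<^sup>2 + q\<^sup>2)"
    by (simp add: rate_def period_def Re_divide Im_divide diff_divide_distrib mult.commute)
  also have "\<dots> > 0"
    using un period_nonzero by (simp add: period_def complex_eq_iff sum_power2_gt_zero_iff)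
  finally have "Re (rate * Complex (of_int m) (of_int n)) > 0" .
  moreover have "Re (rate * (of_real (2 * pi) * Complex (of_int m) (of_int n))) =
    2 * pi * Re (rate * Complex (of_int m) (of_int n))"
    by (simp add: algebra_simps)
  ultimately show ?thesis
    by (simp add: multiplier_def)
qed

lemma exp_rate_period: "exp (rate * (of_real (2 * pi) * of_int k * period)) = 1"
proof -
  have "rate * (of_real (2 * pi) * of_int k * period) = of_int (2 * k) * of_real pi * \<i>"
    using period_nonzero by (simp add: rate_def)
  then show ?thesis by (simp only: exp_eq_1) auto
qed

lemma torus_proj_eq_iff_exp:
  "torus_proj w = torus_proj w' \<longleftrightarrow>
    (\<exists>j. exp (rate * w) = multiplier powi j * exp (rate * w'))"
proof
  assume "torus_proj w = torus_proj w'"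
  then obtain k l :: int where w: "w = w' + of_real (2 * pi) * Complex (of_int k) (of_int l)"
    unfolding torus_proj_eq_iff by blast
  \<comment> \<open>Cramer's rule for the coordinates of \<open>(k, l)\<close> in the lattice basis
    \<open>(p, q)\<close>, \<open>(m, n)\<close>. The exponential forgets the first coordinate and
    turns the second into a power of \<open>multiplier\<close>.\<close>
  define i j where "i = m * l - n * k" and "j = q * k - p * l"
  have "k = i * p + j * m" "l = i * q + j * n"
    unfolding i_def j_def using unimodular by algebra+
  then have "Complex (of_int k) (of_int l) = of_int i * period + of_int j * Complex (of_int m) (of_int n)"
    by (simp add: period_def complex_eq_iff)
  then have "rate * w = of_int j * (rate * (of_real (2 * pi) * Complex (of_int m) (of_int n)))
      + rate * w' + rate * (of_real (2 * pi) * of_int i * period)"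
    by (simp add: w algebra_simps)
  then have "exp (rate * w) = multiplier powi j * exp (rate * w')"
    unfolding multiplier_def exp_power_int by (simp only: exp_add exp_rate_period mult_1_right)
  then show "\<exists>j. exp (rate * w) = multiplier powi j * exp (rate * w')" ..
next
  assume "\<exists>j. exp (rate * w) = multiplier powi j * exp (rate * w')"
  then obtain j where "exp (rate * w) = multiplier powi j * exp (rate * w')" ..
  then have "exp (rate * w) =
      exp (of_int j * (rate * (of_real (2 * pi) * Complex (of_int m) (of_int n))) + rate * w')"
    unfolding multiplier_def exp_power_int by (simp only: exp_add)
  then obtain i :: int where
    "rate * w = of_int j * (rate * (of_real (2 * pi) * Complex (of_int m) (of_int n))) + rate * w'
      + (of_int (2 * i) * pi) * \<i>"
    unfolding exp_eq by blast
  moreover have "(of_int (2 * i) * pi) * \<i> = rate * (of_real (2 * pi) * of_int i * period)"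
    using period_nonzero by (simp add: rate_def)
  ultimately have "rate * w = rate * (w' + of_real (2 * pi) * (of_int j * Complex (of_int m) (of_int n) + of_int i * period))"
    by (simp only:) (simp add: algebra_simps)
  then have "w = w' + of_real (2 * pi) * (of_int j * Complex (of_int m) (of_int n) + of_int i * period)"
    using rate_nonzero by simp
  also have "of_int j * Complex (of_int m) (of_int n) + of_int i * period =
      Complex (of_int (j * m + i * p)) (of_int (j * n + i * q))"
    by (simp add: period_def complex_eq_iff)
  finally show "torus_proj w = torus_proj w'"
    unfolding torus_proj_eq_iff by blast
qed

lemma exp_rate_Ln: "z \<noteq> 0 \<Longrightarrow> exp (rate * (Ln z / rate)) = z"
  using rate_nonzero by simp

lemma tate_proj_eq_iff:
  assumes "z \<noteq> 0" "z' \<noteq> 0"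
  shows "tate_proj z = tate_proj z' \<longleftrightarrow> (\<exists>j. z = multiplier powi j * z')"
  unfolding tate_proj_def torus_proj_eq_iff_exp exp_rate_Ln[OF assms(1)] exp_rate_Ln[OF assms(2)] ..

lemma tate_proj_exp [simp]: "tate_proj (exp (rate * w)) = torus_proj w"
proof -
  have "exp (rate * (Ln (exp (rate * w)) / rate)) = multiplier powi 0 * exp (rate * w)"
    by (simp add: exp_rate_Ln)
  then show ?thesis
    unfolding tate_proj_def torus_proj_eq_iff_exp by blast
qed

lemma tate_proj_multiplier_powi: "z \<noteq> 0 \<Longrightarrow> tate_proj (multiplier powi j * z) = tate_proj z"
  by (subst tate_proj_eq_iff) (auto simp: power_int_eq_0_iff)

lemma tate_proj_in_torus [simp]: "tate_proj z \<in> torus"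
  by (simp add: tate_proj_def)

lemma tate_proj_surj:
  assumes "x \<in> torus"
  obtains z where "z \<noteq> 0" "x = tate_proj z"
  using torus_proj_surj[OF assms] tate_proj_exp by (metis exp_not_eq_zero)

text \<open>The principal \<open>Ln\<close> in \<open>tate_proj\<close> jumps across its cut. On a
  small disc, which is simply connected, \<open>f\<close> has a holomorphic logarithm instead, and
  the projection is blind to the change of branch.\<close>

lemma smooth_on_tate_proj:
  assumes S: "open S" and L: "bounded_linear L" and f: "f holomorphic_on S" "\<And>z. z \<in> S \<Longrightarrow> f z \<noteq> 0"
  shows "smooth_on (L -` S) (\<lambda>x. tate_proj (f (L x)))"
  unfolding smooth_on_def
proof (intro allI Ck_on_locally)
  fix k x assume x: "x \<in> L -` S"
  then obtain e where e: "e > 0" "ball (L x) e \<subseteq> S"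
    using S openE by blast
  then have "f holomorphic_on ball (L x) e" "\<And>z. z \<in> ball (L x) e \<Longrightarrow> f z \<noteq> 0"
    using f holomorphic_on_subset by blast+
  moreover have "simply_connected (ball (L x) e)"
    by (simp add: convex_imp_simply_connected)
  ultimately obtain g where g: "g holomorphic_on ball (L x) e" "\<And>z. z \<in> ball (L x) e \<Longrightarrow> f z = exp (g z)"
    using simply_connected_eq_holomorphic_log[OF open_ball] by metis
  have "Ck_on k (L -` ball (L x) e) (\<lambda>x. torus_proj (g (L x) / rate))"
    using rate_nonzero
    by (intro Ck_on_torus_proj[OF open_ball L, of "\<lambda>z. g z / rate"]) (auto intro!: holomorphic_intros g(1))
  moreover have "\<forall>y\<in>L -` ball (L x) e. tate_proj (f (L y)) = torus_proj (g (L y) / rate)"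
    using g(2) rate_nonzero tate_proj_exp by (metis nonzero_mult_div_cancel_left times_divide_eq_right vimage_eq)
  moreover have "open (L -` ball (L x) e)"
    using L continuous_open_vimage linear_continuous_at by blast
  ultimately show "\<exists>U h. open U \<and> x \<in> U \<and> Ck_on k U h \<and> (\<forall>y\<in>U. tate_proj (f (L y)) = h y)"
    using e(1) by (intro exI[of _ "L -` ball (L x) e"] exI[of _ "\<lambda>x. torus_proj (g (L x) / rate)"]) simp
qed

end

text \<open>\<open>I\<close> and \<open>S\<close> stand for the interior of a Jordan curve around \<open>0\<close> and its closure. The half-open
  annulus \<open>multiplier \<cdot> I - I\<close> is a fundamental domain, and its part \<open>S - I\<close> is the curve along which the
  torus is cut.\<close>

locale torus_annulus = torus_cover +
  fixes I S :: "complex set"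
  assumes open_I: "open I" and zero_in_I: "0 \<in> I" and compact_S: "compact S"
    and I_subset_S: "I \<subseteq> S" and S_subset: "S \<subseteq> (*) multiplier ` I"
begin

definition annulus :: "complex set" where
  "annulus = (*) multiplier ` I - S"

definition slit :: "(complex \<times> complex) set" where
  "slit = tate_proj ` (S - I)"

definition chart :: "complex \<times> complex \<Rightarrow> real^2" where
  "chart x = of_complex (the_inv_into annulus tate_proj x)"

lemma annulus_Un: "(*) multiplier ` I - I = annulus \<union> (S - I)"
  using I_subset_S S_subset by (auto simp: annulus_def)

lemma open_annulus: "open annulus"
proof -
  have "(*) multiplier ` I = (\<lambda>z. inverse multiplier * z) -` I"
    by (auto simp: field_simps intro!: image_eqI[of _ _ "inverse multiplier * _"])
  then have "open ((*) multiplier ` I)"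
    using open_I by (auto intro!: continuous_open_vimage continuous_intros)
  then show ?thesis
    unfolding annulus_def by (intro open_Diff compact_imp_closed[OF compact_S])
qed

lemma zero_notin_annulus: "0 \<notin> annulus"
  using zero_in_I I_subset_S by (auto simp: annulus_def)

lemma contract_I: "z \<in> I \<Longrightarrow> inverse multiplier ^ k * z \<in> I"
proof (induction k arbitrary: z)
  case (Suc k)
  then obtain v where "v \<in> I" "z = multiplier * v"
    using I_subset_S S_subset by blast
  then show ?case
    using Suc.IH[of v] by (simp add: field_simps)
qed simp

text \<open>Otherwise \<open>z\<close> would arise from a point of \<open>I\<close> by a nonpositive
  power of \<open>multiplier\<close>, and such contractions keep \<open>I\<close> in itself.\<close>

lemma fundamental_unique_pos:
  assumes "z \<in> (*) multiplier ` I - I" "j > 0"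
  shows "multiplier powi j * z \<notin> (*) multiplier ` I"
proof
  assume "multiplier powi j * z \<in> (*) multiplier ` I"
  then obtain v where v: "v \<in> I" "multiplier powi j * z = multiplier * v" by auto
  define k where "k = nat (j - 1)"
  have "j = int k + 1" using assms(2) by (simp add: k_def)
  then have "multiplier powi j = multiplier * multiplier ^ k"
    by (simp add: power_int_add)
  then have "z = inverse multiplier ^ k * v"
    using v(2) by (simp add: field_simps)
  then show False using contract_I[OF v(1)] assms(1) by auto
qed

lemma fundamental_unique:
  assumes z: "z \<in> (*) multiplier ` I - I" "multiplier powi j * z \<in> (*) multiplier ` I - I"
  shows "j = 0"
proof -
  have eq: "multiplier powi (- j) * (multiplier powi j * z) = z"
    by (simp add: power_int_minus field_simps)
  have "\<not> - j > 0"
    using fundamental_unique_pos[OF z(2), of "- j"] z(1) unfolding eq by blast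
  moreover have "\<not> j > 0"
    using fundamental_unique_pos[OF z(1)] z(2) by auto
  ultimately show ?thesis by simp
qed

text \<open>As the exponent decreases, the multiples of \<open>z\<close> pass from outside
  \<open>S\<close> to near \<open>0\<close>. The exponent just before the first entry into
  \<open>I\<close> is the one sought.\<close>

lemma fundamental_exists:
  assumes "z \<noteq> 0"
  obtains j where "multiplier powi j * z \<in> (*) multiplier ` I - I"
proof -
  obtain B where B: "\<And>x. x \<in> S \<Longrightarrow> cmod x \<le> B"
    using compact_imp_bounded[OF compact_S] unfolding bounded_iff by blast
  obtain e where e: "e > 0" "ball 0 e \<subseteq> I"
    using open_I zero_in_I openE by blast
  obtain N where N: "B / cmod z < cmod multiplier ^ N"
    using real_arch_pow[OF norm_multiplier] by blast
  obtain M where M: "cmod z / e < cmod multiplier ^ M"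
    using real_arch_pow[OF norm_multiplier] by blast
  let ?P = "\<lambda>i::nat. multiplier powi (int N - int i) * z \<in> I"
  have "cmod (multiplier powi (int N - int (N + M)) * z) = cmod z / cmod multiplier ^ M"
    by (simp add: norm_mult power_int_minus norm_inverse norm_power divide_inverse)
  also have "\<dots> < e"
    using M e(1) norm_multiplier by (simp add: field_simps)
  finally have P: "?P (N + M)"
    using e(2) by auto
  have "cmod (multiplier powi (int N - int 0) * z) > B"
    using N assms by (simp add: norm_mult norm_power field_simps)
  then have "\<not> ?P 0"
    using B I_subset_S by fastforce
  then obtain i where i: "\<not> ?P i" "?P (Suc i)"
    using P ex_least_nat_less[of ?P "N + M"] by blast
  have "multiplier powi (int N - int i) * z = multiplier * (multiplier powi (int N - int (Suc i)) * z)"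
    by (simp add: power_int_diff power_int_add field_simps)
  with i that[of "int N - int i"] show thesis by auto
qed

lemma nonzero_if_fundamental: "z \<in> (*) multiplier ` I - I \<Longrightarrow> z \<noteq> 0"
  using zero_in_I by auto

lemma inj_on_tate_proj: "inj_on tate_proj ((*) multiplier ` I - I)"
proof (rule inj_onI)
  fix z w assume zw: "z \<in> (*) multiplier ` I - I" "w \<in> (*) multiplier ` I - I" "tate_proj z = tate_proj w"
  then obtain j where j: "z = multiplier powi j * w"
    using nonzero_if_fundamental by (subst (asm) tate_proj_eq_iff) auto
  with fundamental_unique[of w j] zw show "z = w" by simp
qed

lemma tate_proj_annulus: "tate_proj ` annulus = torus - slit"
proof -
  have "tate_proj ` ((*) multiplier ` I - I) = torus"
  proof
    show "torus \<subseteq> tate_proj ` ((*) multiplier ` I - I)"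
    proof
      fix x assume "x \<in> torus"
      then obtain z where z: "z \<noteq> 0" "x = tate_proj z" by (rule tate_proj_surj)
      then obtain j where "multiplier powi j * z \<in> (*) multiplier ` I - I"
        using fundamental_exists by blast
      then show "x \<in> tate_proj ` ((*) multiplier ` I - I)"
        unfolding z(2) tate_proj_multiplier_powi[OF z(1), of j, symmetric] by (rule imageI)
    qed
  qed auto
  moreover have "tate_proj ` annulus \<inter> slit = {}"
    using inj_on_image_Int[OF inj_on_tate_proj, of annulus "S - I"]
    unfolding slit_def annulus_Un by (auto simp: annulus_def)
  ultimately show ?thesis
    unfolding annulus_Un image_Un slit_def[symmetric] by blast
qed

lemma inj_on_tate_proj_annulus: "inj_on tate_proj annulus"
  using inj_on_tate_proj inj_on_subset unfolding annulus_Un by blast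

lemma chart_tate_proj: "z \<in> annulus \<Longrightarrow> chart (tate_proj z) = of_complex z"
  by (simp add: chart_def the_inv_into_f_f[OF inj_on_tate_proj_annulus])

lemma bij_betw_chart: "bij_betw chart (torus - slit) (of_complex ` annulus)"
  by (rule bij_betw_byWitness[where f' = "\<lambda>v. tate_proj (to_complex v)"])
     (auto simp: tate_proj_annulus[symmetric] chart_tate_proj)

lemma inv_chart: "z \<in> annulus \<Longrightarrow> the_inv_into (torus - slit) chart (of_complex z) = tate_proj z"
  by (rule the_inv_into_f_eq)
     (use bij_betw_chart tate_proj_annulus in \<open>auto simp: bij_betw_def chart_tate_proj\<close>)

text \<open>Some power of \<open>multiplier\<close> brings \<open>exp (rate * to_complex v)\<close>
  into \<open>annulus\<close>. As \<open>annulus\<close> is open, the same power serves all nearby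
  points.\<close>

lemma chart_torus_pt_locally:
  assumes "torus_pt v \<in> torus - slit"
  obtains U j where "open U" "v \<in> U"
    "\<forall>y\<in>U. chart (torus_pt y) = of_complex (multiplier powi j * exp (rate * to_complex y))"
proof -
  obtain z where z: "z \<in> annulus" "torus_pt v = tate_proj z"
    using assms unfolding tate_proj_annulus[symmetric] by auto
  have "tate_proj z = tate_proj (exp (rate * to_complex v))"
    using z(2) by (simp add: torus_pt_eq_torus_proj)
  then obtain j where j: "z = multiplier powi j * exp (rate * to_complex v)"
    using z(1) zero_notin_annulus by (subst (asm) tate_proj_eq_iff) auto
  let ?e = "\<lambda>y. multiplier powi j * exp (rate * y)"
  let ?U = "to_complex -` ?e -` annulus"
  have pt: "torus_pt y = tate_proj (?e (to_complex y))" for y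
    by (simp add: tate_proj_multiplier_powi torus_pt_eq_torus_proj)
  show thesis
  proof
    show "open ?U"
      by (intro open_to_complex_vimage continuous_open_vimage open_annulus continuous_intros)
    show "v \<in> ?U" using z j by simp
    show "\<forall>y\<in>?U. chart (torus_pt y) = of_complex (?e (to_complex y))"
      unfolding pt tate_proj_annulus[symmetric] by (auto simp: chart_tate_proj pt)
  qed
qed

lemma smooth_on_chart: "smooth_on (torus_pt -` (torus - slit)) (chart \<circ> torus_pt)"
  unfolding smooth_on_def
proof (intro allI Ck_on_locally)
  fix k v assume "v \<in> torus_pt -` (torus - slit)"
  then obtain U j where U: "open U" "v \<in> U"
    "\<forall>y\<in>U. chart (torus_pt y) = of_complex (multiplier powi j * exp (rate * to_complex y))"
    unfolding vimage_eq by (rule chart_torus_pt_locally)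
  have "Ck_on k (to_complex -` UNIV) (\<lambda>y. multiplier powi j * exp (rate * to_complex y))"
    by (rule Ck_on_holomorphic[OF open_UNIV bounded_linear_to_complex]) (intro holomorphic_intros)
  then have "Ck_on k UNIV (\<lambda>y. of_complex (multiplier powi j * exp (rate * to_complex y)))"
    unfolding vimage_UNIV by (rule Ck_on_bounded_linear[OF open_UNIV bounded_linear_of_complex])
  from Ck_on_subset[OF this subset_UNIV] U
  show "\<exists>U g. open U \<and> v \<in> U \<and> Ck_on k U g \<and> (\<forall>y\<in>U. (chart \<circ> torus_pt) y = g y)"
    unfolding comp_apply by blast
qed

lemma torus_diffeo_chart: "torus_diffeo (torus - slit) (of_complex ` annulus) chart"
  unfolding torus_diffeo_def
proof (intro conjI bij_betw_chart smooth_on_chart)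
  have "smooth_on (to_complex -` annulus) (\<lambda>v. tate_proj (to_complex v))"
    by (rule smooth_on_tate_proj[OF open_annulus bounded_linear_to_complex, of "\<lambda>z. z"])
       (use zero_notin_annulus in \<open>auto intro: holomorphic_intros\<close>)
  moreover have "the_inv_into (torus - slit) chart v = tate_proj (to_complex v)"
    if "v \<in> to_complex -` annulus" for v
    using inv_chart[of "to_complex v"] that by simp
  ultimately show "smooth_on (of_complex ` annulus) (the_inv_into (torus - slit) chart)"
    unfolding smooth_on_def of_complex_image_eq
    using open_to_complex_vimage[OF open_annulus]
    by (intro allI Ck_on_locally exI[of _ "to_complex -` annulus"]
        exI[of _ "\<lambda>v. tate_proj (to_complex v)"]) auto
qed

text \<open>In the coordinates of the torus, \<open>chart\<close> is locally a constant times
  \<open>exp (rate * w)\<close>, whose derivative is \<open>rate\<close> times its value. A constant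
  vector is therefore sent to a fixed complex multiple of the position.\<close>

lemma push_field_chart:
  assumes "z \<in> annulus"
  shows "push_field (torus - slit) chart (constant_field a b) (of_complex z) =
    of_complex (rate * Complex a b * z)"
proof -
  \<comment> \<open>One point of the plane above the given point of the torus; by
    \<open>torus_differential_eq\<close> it may replace the point chosen in
    \<open>torus_differential\<close>.\<close>
  define v where "v = of_complex (Ln z / rate)"
  have z: "z \<noteq> 0" using assms zero_notin_annulus by auto
  have v: "torus_pt v = tate_proj z"
    by (simp add: v_def tate_proj_def torus_pt_eq_torus_proj)
  then have "torus_pt v \<in> torus - slit"
    using assms tate_proj_annulus by auto
  then obtain U j where U: "open U" "v \<in> U"
    "\<forall>y\<in>U. chart (torus_pt y) = of_complex (multiplier powi j * exp (rate * to_complex y))"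
    by (rule chart_torus_pt_locally)
  have j: "z = multiplier powi j * exp (rate * to_complex v)"
    using bspec[OF U(3,2)] by (simp add: v chart_tate_proj[OF assms])
  have "((\<lambda>w. multiplier powi j * exp (rate * w)) has_field_derivative rate * z) (at (to_complex v))"
    by (auto intro!: derivative_eq_intros simp: j)
  then have "((\<lambda>w. multiplier powi j * exp (rate * w)) has_derivative (*) (rate * z)) (at (to_complex v))"
    by (simp add: has_field_derivative_def)
  from has_derivative_compose[OF bounded_linear_imp_has_derivative[OF bounded_linear_to_complex] this]
  have "((\<lambda>y. of_complex (multiplier powi j * exp (rate * to_complex y))) has_derivative
      (\<lambda>h. of_complex (rate * z * to_complex h))) (at v)"
    by (rule bounded_linear.has_derivative[OF bounded_linear_of_complex])
  then have der: "((chart \<circ> torus_pt) has_derivative (\<lambda>h. of_complex (rate * z * to_complex h))) (at v)"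
    by (rule has_derivative_transform_within_open[OF _ U(1,2)]) (simp add: U(3))
  have "push_field (torus - slit) chart (constant_field a b) (of_complex z) =
      torus_differential chart (torus_pt v) (vector [a, b])"
    by (simp add: push_field_def inv_chart[OF assms] constant_field_def v)
  also have "\<dots> = of_complex (rate * z * to_complex (vector [a, b]))"
    unfolding torus_differential_eq[OF differentiableI[OF der]] frechet_derivative_at[OF der, symmetric] ..
  finally show ?thesis by (simp add: mult_ac)
qed

end

subsection \<open>Curves\<close>

lemma inj_on_circle:
  assumes "r \<noteq> 0"
  shows "inj_on (\<lambda>t. complex_of_real r * cis t) {0..<2 * pi}"
proof (rule inj_onI)
  fix s t :: real
  assume st: "s \<in> {0..<2 * pi}" "t \<in> {0..<2 * pi}" "complex_of_real r * cis s = complex_of_real r * cis t"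
  then obtain k :: int where k: "s = t + 2 * pi * of_int k"
    using assms by (auto simp: cis_eq_cis_iff)
  have "pi * real_of_int k < pi * 1" "pi * - 1 < pi * real_of_int k"
    using k st(1,2) unfolding atLeastLessThan_iff by linarith+
  then have "k = 0"
    unfolding mult_less_cancel_left_pos[OF pi_gt_zero] by linarith
  with k show "s = t" by simp
qed

lemma circle_image:
  assumes "r \<ge> 0"
  shows "(\<lambda>t. complex_of_real r * cis t) ` {0..2 * pi} = sphere 0 r"
proof
  show "sphere 0 r \<subseteq> (\<lambda>t. complex_of_real r * cis t) ` {0..2 * pi}"
  proof
    fix z :: complex assume "z \<in> sphere 0 r"
    then have "z = complex_of_real r * cis (Arg2pi z)"
      using Arg2pi_eq[of z] by (simp add: cis_conv_exp)
    moreover have "Arg2pi z \<in> {0..2 * pi}"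
      using Arg2pi_ge_0[of z] Arg2pi_lt_2pi[of z] by simp
    ultimately show "z \<in> (\<lambda>t. complex_of_real r * cis t) ` {0..2 * pi}"
      by blast
  qed
qed (use assms in \<open>auto simp: norm_mult\<close>)

text \<open>With a complex parameter the curve becomes the restriction of a holomorphic function to
  the real axis, so its smoothness follows from \<open>Ck_on_holomorphic\<close> with
  \<open>of_real\<close>.\<close>

lemma holomorphic_on_circle:
  assumes "h holomorphic_on ball 0 1"
  shows "open {z. cmod (of_real r * exp (\<i> * z)) < 1}"
    "(\<lambda>z. h (of_real r * exp (\<i> * z))) holomorphic_on {z. cmod (of_real r * exp (\<i> * z)) < 1}"
proof -
  show "open {z. cmod (of_real r * exp (\<i> * z)) < 1}"
    by (intro open_Collect_less continuous_intros)
  have "h \<circ> (\<lambda>z. of_real r * exp (\<i> * z)) holomorphic_on {z. cmod (of_real r * exp (\<i> * z)) < 1}"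
    by (rule holomorphic_on_compose_gen[OF _ assms]) (auto intro!: holomorphic_intros)
  then show "(\<lambda>z. h (of_real r * exp (\<i> * z))) holomorphic_on {z. cmod (of_real r * exp (\<i> * z)) < 1}"
    by (simp add: o_def)
qed

lemma jordan_curve_disc_circle:
  assumes h: "h holomorphic_on ball 0 1" "inj_on h (ball 0 1)" and r: "0 < r" "r < 1"
  shows "jordan_curve (\<lambda>t. of_complex (h (of_real r * cis t)))"
    "curve_image (\<lambda>t. of_complex (h (of_real r * cis t))) = of_complex ` h ` sphere 0 r"
proof -
  show "curve_image (\<lambda>t. of_complex (h (of_real r * cis t))) = of_complex ` h ` sphere 0 r"
    using r by (simp add: curve_image_def circle_image[symmetric] image_image)
  have "Ck_on k (of_real -` {z. cmod (of_real r * exp (\<i> * z)) < 1}) (\<lambda>t. h (of_real r * exp (\<i> * of_real t)))" for k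
    by (rule Ck_on_holomorphic[OF holomorphic_on_circle(1)[OF h(1)] bounded_linear_of_real
          holomorphic_on_circle(2)[OF h(1)]])
  moreover have "of_real -` {z. cmod (of_real r * exp (\<i> * z)) < 1} = (UNIV :: real set)"
    using r by (auto simp: norm_mult)
  ultimately have "Ck_on k UNIV (\<lambda>t. h (of_real r * cis t))" for k
    by (simp add: cis_conv_exp)
  then have "smooth_on UNIV (\<lambda>t. of_complex (h (of_real r * cis t)))"
    by (simp add: smooth_on_def Ck_on_bounded_linear[OF open_UNIV bounded_linear_of_complex])
  moreover have "inj_on (h \<circ> (\<lambda>t. of_real r * cis t)) {0..<2 * pi}"
    using r by (intro comp_inj_on inj_on_circle inj_on_subset[OF h(2)]) (auto simp: norm_mult)
  ultimately show "jordan_curve (\<lambda>t. of_complex (h (of_real r * cis t)))"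
    unfolding jordan_curve_def by (simp add: cis_mult[symmetric] inj_on_def)
qed

lemma torus_mem_normD: "x \<in> torus \<Longrightarrow> cmod (fst x) = 1" "x \<in> torus \<Longrightarrow> cmod (snd x) = 1"
  by (auto simp: torus_def)

lemma torus_jordan_curve_mem:
  assumes "torus_jordan_curve \<Gamma>"
  shows "\<Gamma> t \<in> curve_image \<Gamma>"
proof -
  have per: "\<Gamma> (s + 2 * pi * of_int k) = \<Gamma> s" for s k
  proof (induction k rule: int_induct[where k = 0])
    case (step1 i)
    then show ?case
      using assms unfolding torus_jordan_curve_def jordan_curve_def
      by (metis (no_types, lifting) add.assoc distrib_left mult.right_neutral of_int_1 of_int_add)
  next
    case (step2 i)
    then show ?case
      using assms unfolding torus_jordan_curve_def jordan_curve_def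
      by (metis (no_types, lifting) add_diff_eq diff_add_cancel right_diff_distrib mult.right_neutral of_int_1 of_int_diff)
  qed simp
  define k where "k = - \<lfloor>t / (2 * pi)\<rfloor>"
  have "- of_int k \<le> t / (2 * pi)" "t / (2 * pi) \<le> - of_int k + 1"
    using floor_correct[of "t / (2 * pi)"] unfolding k_def by linarith+
  moreover have "0 < 2 * pi" by simp
  ultimately have "- of_int k * (2 * pi) \<le> t" "t \<le> (- of_int k + 1) * (2 * pi)"
    by (simp_all only: pos_le_divide_eq pos_divide_le_eq)
  then have "t + 2 * pi * of_int k \<in> {0..2 * pi}"
    by (simp add: algebra_simps)
  then show ?thesis
    unfolding curve_image_def using per[of t k] by (metis imageI)
qed

lemma cis_Im_Ln: "cmod z = 1 \<Longrightarrow> cis (Im (Ln z)) = z"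
  by (metis Re_Ln exp_Ln exp_eq_polar ln_one mult_1 norm_zero of_real_1 exp_zero zero_neq_one)

text \<open>Smoothness of \<open>chart\<close> is known after composition with
  \<open>torus_pt\<close>, so curves have to be lifted. Division by the value at \<open>t\<close>
  makes the argument of \<open>Ln\<close> equal to \<open>1\<close> at \<open>s = t\<close>, where
  \<open>Ln\<close> is differentiable; jumps at other parameters still leave a lift.\<close>

lemma differentiable_torus_lift:
  fixes \<Gamma> :: "real \<Rightarrow> complex \<times> complex"
  assumes "\<And>s. \<Gamma> s \<in> torus" "\<Gamma> differentiable (at t)"
  obtains l where "l differentiable (at t)" "\<And>s. torus_pt (l s) = \<Gamma> s"
proof -
  obtain w where w: "\<Gamma> t = torus_proj w"
    using torus_proj_surj[OF assms(1)[of t]] by blast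
  let ?f = "\<lambda>s. fst (\<Gamma> s) / fst (\<Gamma> t)" and ?g = "\<lambda>s. snd (\<Gamma> s) / snd (\<Gamma> t)"
  let ?l = "\<lambda>s. w + (of_real (Im (Ln (?f s))) + \<i> * of_real (Im (Ln (?g s))))"
  have n: "cmod (fst (\<Gamma> s)) = 1" "cmod (snd (\<Gamma> s)) = 1" for s
    using torus_mem_normD[OF assms(1)] by auto
  then have nz: "fst (\<Gamma> t) \<noteq> 0" "snd (\<Gamma> t) \<noteq> 0"
    by (metis norm_zero zero_neq_one)+
  have Ln: "(\<lambda>s. A (Im (Ln (h s)))) differentiable (at t)"
    if "h differentiable (at t)" "h t = 1" "bounded_linear A" for h :: "real \<Rightarrow> complex" and A :: "real \<Rightarrow> complex"
  proof -
    have "Ln differentiable (at (h t))"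
      using that by (auto intro!: field_differentiable_imp_differentiable field_differentiable_at_Ln)
    then have "(\<lambda>s. Ln (h s)) differentiable (at t)"
      by (rule differentiable_compose[OF _ that(1)])
    moreover have "bounded_linear (\<lambda>z. A (Im z))"
      by (rule bounded_linear_compose[OF that(3) bounded_linear_Im])
    ultimately show ?thesis
      using bounded_linear_imp_differentiable differentiable_compose by blast
  qed
  have f: "fst differentiable (at (\<Gamma> t))" "snd differentiable (at (\<Gamma> t))"
    by (auto intro: bounded_linear_imp_differentiable bounded_linear_fst bounded_linear_snd)
  have "?f differentiable (at t)" "?g differentiable (at t)"
    using differentiable_compose[OF f(1) assms(2)] differentiable_compose[OF f(2) assms(2)] nz
    by (auto intro!: derivative_intros)
  then have "?l differentiable (at t)"
    using nz by (intro differentiable_add differentiable_const Ln bounded_linear_of_real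
        bounded_linear_compose[OF bounded_linear_mult_right bounded_linear_of_real]) auto
  then have "(\<lambda>s. of_complex (?l s)) differentiable (at t)"
    using bounded_linear_imp_differentiable[OF bounded_linear_of_complex] differentiable_compose by blast
  moreover have "torus_pt (of_complex (?l s)) = \<Gamma> s" for s
  proof -
    have "cis (Im (Ln (?f s))) = ?f s" "cis (Im (Ln (?g s))) = ?g s"
      using n by (simp_all add: cis_Im_Ln norm_divide)
    moreover have "\<Gamma> t = (cis (Re w), cis (Im w))"
      unfolding w torus_proj_def ..
    ultimately show ?thesis
      using nz by (simp add: torus_pt_eq_torus_proj torus_proj_def cis_mult[symmetric] prod_eq_iff)
  qed
  ultimately show thesis by (rule that)
qed

section \<open>Index of the transported field\<close>

context torus_annulus
begin

lemma differentiable_chart_curve: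
  fixes \<Gamma> :: "real \<Rightarrow> complex \<times> complex"
  assumes "\<And>s. \<Gamma> s \<in> torus - slit" "\<Gamma> differentiable (at t)"
  shows "(\<lambda>s. chart (\<Gamma> s)) differentiable (at t)"
proof -
  obtain l where l: "l differentiable (at t)" "\<And>s. torus_pt (l s) = \<Gamma> s"
    using differentiable_torus_lift[of \<Gamma> t] assms by blast
  have "Ck_on (Suc 0) (torus_pt -` (torus - slit)) (chart \<circ> torus_pt)"
    using smooth_on_chart by (simp only: smooth_on_def)
  then have "(chart \<circ> torus_pt) differentiable (at (l t))"
    using l(2)[of t] assms(1)[of t] by simp
  from differentiable_compose[OF this l(1)] show ?thesis
    by (simp add: l(2))
qed

text \<open>The transported field is multiplication by a constant \<open>k\<close>, so along the
  curve it equals \<open>exp (Ln k + rate * \<gamma> t)\<close>, and the imaginary part of the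
  exponent is a continuous angle. Its total change is \<open>2 * pi\<close> because
  \<open>rate * period\<close> is \<open>\<i>\<close>.\<close>

lemma field_index_chart:
  assumes \<Gamma>: "\<And>s. \<Gamma> s \<in> torus - slit" "\<And>t. \<Gamma> differentiable (at t)"
    and \<gamma>: "continuous_on {0..2 * pi} \<gamma>" "\<And>t. t \<in> {0..2 * pi} \<Longrightarrow> torus_proj (\<gamma> t) = \<Gamma> t"
      "\<And>t. t \<in> {0..2 * pi} \<Longrightarrow> exp (rate * \<gamma> t) \<in> annulus"
      "\<gamma> (2 * pi) - \<gamma> 0 = of_real (2 * pi) * period"
    and ab: "(a, b) \<noteq> (0, 0)"
  shows "field_index (push_field (torus - slit) chart (constant_field a b)) (chart \<circ> \<Gamma>) = 1"
proof -
  let ?X = "push_field (torus - slit) chart (constant_field a b)"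
  let ?k = "rate * Complex a b"
  have k: "?k \<noteq> 0"
    using ab rate_nonzero by (simp add: Complex_eq_0)
  have X: "?X ((chart \<circ> \<Gamma>) s) = of_complex (?k * to_complex (chart (\<Gamma> s)))" for s
  proof -
    obtain z where "z \<in> annulus" "\<Gamma> s = tate_proj z"
      using \<Gamma>(1)[of s] unfolding tate_proj_annulus[symmetric] by blast
    then show ?thesis by (simp add: chart_tate_proj push_field_chart)
  qed
  have \<Gamma>_eq: "chart (\<Gamma> t) = of_complex (exp (rate * \<gamma> t))" if "t \<in> {0..2 * pi}" for t
    using chart_tate_proj[OF \<gamma>(3)[OF that]] \<gamma>(2)[OF that] by simp
  have XE: "?X ((chart \<circ> \<Gamma>) t) = of_complex (exp (Ln ?k + rate * \<gamma> t))" if "t \<in> {0..2 * pi}" for t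
    using k unfolding X \<Gamma>_eq[OF that] by (simp add: exp_add)
  let ?\<theta> = "\<lambda>t. Im (Ln ?k + rate * \<gamma> t)"
  have "field_index ?X (chart \<circ> \<Gamma>) = (?\<theta> (2 * pi) - ?\<theta> 0) / (2 * pi)"
  proof (rule field_index_angle)
    fix t :: real assume t: "t \<in> {0..2 * pi}"
    have "bounded_linear (\<lambda>v. of_complex (?k * to_complex v))"
      by (intro bounded_linear_compose[OF bounded_linear_of_complex]
          bounded_linear_compose[OF bounded_linear_mult_right] bounded_linear_to_complex)
    then show "(\<lambda>s. ?X ((chart \<circ> \<Gamma>) s)) differentiable (at t)"
      unfolding X
      by (rule differentiable_compose[OF bounded_linear_imp_differentiable differentiable_chart_curve[OF \<Gamma>(1,2)]])
    have "norm (?X ((chart \<circ> \<Gamma>) t)) > 0"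
      unfolding XE[OF t] norm_of_complex by simp
    then show "?X ((chart \<circ> \<Gamma>) t) \<noteq> 0" by force
    show "?X ((chart \<circ> \<Gamma>) t) = norm (?X ((chart \<circ> \<Gamma>) t)) *\<^sub>R vector [cos (?\<theta> t), sin (?\<theta> t)]"
      unfolding XE[OF t] norm_of_complex unfolding exp_eq_polar[of "Ln ?k + rate * \<gamma> t"]
      by (simp add: norm_mult vec_eq_iff forall_2 of_complex_def)
  qed (auto intro!: continuous_intros \<gamma>(1))
  also have "?\<theta> (2 * pi) - ?\<theta> 0 = Im (rate * (\<gamma> (2 * pi) - \<gamma> 0))"
    by (simp add: algebra_simps)
  also have "rate * (\<gamma> (2 * pi) - \<gamma> 0) = of_real (2 * pi) * \<i>"
    using period_nonzero by (simp add: \<gamma>(4) rate_def)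
  finally show ?thesis by (simp add: o_def)
qed

end

section \<open>Lifting the curve and cutting the torus\<close>

context torus_cover
begin

lemma exists_index_one:
  assumes \<Gamma>: "torus_jordan_curve \<Gamma>"
    and \<gamma>: "continuous_on {0..2 * pi} \<gamma>" "\<And>t. t \<in> {0..2 * pi} \<Longrightarrow> torus_proj (\<gamma> t) = \<Gamma> t"
      "\<gamma> (2 * pi) - \<gamma> 0 = of_real (2 * pi) * of_int d * period" "d > 0"
    and ab: "(a, b) \<noteq> (0, 0)"
  shows "\<exists>\<Gamma>\<^sub>0 D \<phi>.
    torus_jordan_curve \<Gamma>\<^sub>0 \<and>
    curve_image \<Gamma> \<inter> curve_image \<Gamma>\<^sub>0 = {} \<and>
    jordan_domain D \<and>
    torus_diffeo (torus - curve_image \<Gamma>\<^sub>0) D \<phi> \<and>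
    field_index (push_field (torus - curve_image \<Gamma>\<^sub>0) \<phi> (constant_field a b)) (\<phi> \<circ> \<Gamma>) = 1"
proof -
  \<comment> \<open>\<open>E\<close> lifts the curve to the punctured plane; \<open>k\<close> is the
    same loop on the unit interval, the parameter domain of paths.\<close>
  define E where "E t = exp (rate * \<gamma> t)" for t
  define k where "k s = E (2 * pi * s)" for s
  have I: "2 * pi * s \<in> {0..2 * pi}" if "s \<in> {0..1}" for s :: real
    using that mult_left_mono[of s 1 "2 * pi"] by auto
  have E_image: "path_image k = E ` {0..2 * pi}"
  proof -
    have "t \<in> (*) (2 * pi) ` {0..1}" if "t \<in> {0..2 * pi}" for t
      using that by (intro image_eqI[of _ _ "t / (2 * pi)"]) auto
    then have "(*) (2 * pi) ` {0..1} = {0..2 * pi}" using I by auto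
    then show ?thesis
      unfolding path_image_def k_def by (metis image_image)
  qed
  have E_nz: "E t \<noteq> 0" for t by (simp add: E_def)
  have E_proj: "tate_proj (E t) = \<Gamma> t" if "t \<in> {0..2 * pi}" for t
    using \<gamma>(2)[OF that] by (simp add: E_def)
  have displacement: "rate * \<gamma> (2 * pi) = rate * \<gamma> 0 + rate * (of_real (2 * pi) * of_int d * period)"
    using \<gamma>(3) by (simp add: algebra_simps)
  have E_closed: "E (2 * pi) = E 0"
    unfolding E_def displacement by (simp only: exp_add exp_rate_period mult_1_right)
  have \<Gamma>_inj: "s = t \<or> s = 0 \<and> t = 2 * pi \<or> s = 2 * pi \<and> t = 0"
    if st: "s \<in> {0..2 * pi}" "t \<in> {0..2 * pi}" "\<Gamma> s = \<Gamma> t" for s t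
  proof -
    have inj: "inj_on \<Gamma> {0..<2 * pi}" and "\<Gamma> (0 + 2 * pi) = \<Gamma> 0"
      using \<Gamma> unfolding torus_jordan_curve_def jordan_curve_def by blast+
    then have per: "\<Gamma> (2 * pi) = \<Gamma> 0" by simp
    \<comment> \<open>Moves the endpoint \<open>2 * pi\<close> to \<open>0\<close>, so that
      injectivity on the half-open interval applies.\<close>
    define m :: "real \<Rightarrow> real" where "m u = (if u = 2 * pi then 0 else u)" for u
    have "m s \<in> {0..<2 * pi}" "m t \<in> {0..<2 * pi}" "\<Gamma> (m s) = \<Gamma> (m t)"
      using st per by (auto simp: m_def)
    then have "m s = m t" using inj by (auto dest: inj_onD)
    then show ?thesis by (auto simp: m_def split: if_splits)
  qed
  have path: "path (\<lambda>s. rate * \<gamma> (2 * pi * s))"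
    unfolding path_def using I
    by (intro continuous_intros continuous_on_compose2[OF \<gamma>(1)]) auto
  have k_exp: "k = exp \<circ> (\<lambda>s. rate * \<gamma> (2 * pi * s))"
    by (simp add: k_def E_def fun_eq_iff)
  have simple: "simple_path k"
    unfolding simple_path_def loop_free_def
  proof (intro conjI ballI impI)
    show "path k"
      unfolding k_exp by (intro path_continuous_image[OF path] continuous_intros)
    fix x y :: real assume xy: "x \<in> {0..1}" "y \<in> {0..1}" "k x = k y"
    then have "\<Gamma> (2 * pi * x) = \<Gamma> (2 * pi * y)"
      using E_proj I unfolding k_def by metis
    from \<Gamma>_inj[OF I[OF xy(1)] I[OF xy(2)] this]
    show "x = y \<or> x = 0 \<and> y = 1 \<or> x = 1 \<and> y = 0" by auto
  qed
  have loop: "pathfinish k = pathstart k"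
    by (simp add: pathfinish_def pathstart_def k_def E_closed)
  have zero: "0 \<notin> path_image k"
    unfolding E_image using E_nz by auto
  \<comment> \<open>The loop is the exponential of a path, so it winds by the displacement of that
    path divided by \<open>2 * pi * \<i>\<close>.\<close>
  have "winding_number k 0 = of_int d"
    unfolding k_exp winding_number_compose_exp[OF path]
    by (simp add: pathfinish_def pathstart_def displacement) (simp add: rate_def period_nonzero)
  \<comment> \<open>A simple loop winds \<open>-1\<close>, \<open>0\<close> or \<open>1\<close>
    times, and \<open>d\<close> is positive.\<close>
  then have d: "d = 1" and "winding_number k 0 \<noteq> 0"
    using simple_closed_path_winding_number_cases[OF simple loop zero] \<gamma>(4)
    by (auto simp: complex_eq_iff)
  then have inside: "0 \<in> inside (path_image k)"
    using winding_number_zero_in_outside[OF simple_path_imp_path[OF simple] loop, of 0]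
      inside_Un_outside[of "path_image k"] zero by blast
  let ?c = "inverse multiplier"
  have c: "?c \<noteq> 0" "cmod ?c < 1"
    using norm_multiplier by (auto simp: norm_inverse intro!: inverse_less_1_iff[THEN iffD2])
  \<comment> \<open>A common point would lie over a single point of the torus. Since the curve there
    is simple, \<open>E s\<close> and \<open>E t\<close> would coincide, which the contraction by
    \<open>?c\<close> forbids.\<close>
  have "z \<notin> path_image k" if z: "z \<in> (*) ?c ` path_image k" for z
  proof
    assume "z \<in> path_image k"
    then obtain s t where st: "s \<in> {0..2 * pi}" "t \<in> {0..2 * pi}" "E s = ?c * E t"
      using z unfolding E_image by auto
    have "tate_proj (multiplier powi (- 1) * E t) = tate_proj (E t)"
      by (rule tate_proj_multiplier_powi[OF E_nz])
    then have "\<Gamma> s = \<Gamma> t"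
      using E_proj st by (metis power_int_minus1_right)
    then have "E s = E t" using \<Gamma>_inj[OF st(1,2)] E_closed by auto
    then show False using st(3) E_nz c(2) by auto
  qed
  then have "(*) ?c ` path_image k \<inter> path_image k = {}" by blast
  from obtain_separating_disc[OF simple loop inside c this]
  obtain g r where g: "g holomorphic_on ball 0 1" "inj_on g (ball 0 1)" and r: "0 < r" "r < 1"
    and sub: "(*) ?c ` (path_image k \<union> inside (path_image k)) \<subseteq> g ` ball 0 r"
      "g ` cball 0 r \<subseteq> inside (path_image k)" .
  have scaled: "z \<in> (*) multiplier ` g ` ball 0 r" if "z \<in> path_image k \<union> inside (path_image k)" for z
  proof -
    have "?c * z \<in> g ` ball 0 r" using that sub(1) by blast
    then show ?thesis by (rule image_eqI[rotated]) simp
  qed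
  note top = disc_image_topology[OF g r]
  \<comment> \<open>The inclusion of \<open>S\<close> in the scaled \<open>I\<close> passes through
    the inside of the lifted curve: it contains the closed disc image and is contained in the scaled
    open one.\<close>
  interpret torus_annulus p q m n "g ` ball 0 r" "g ` cball 0 r"
  proof
    have "?c * 0 \<in> g ` ball 0 r" using sub(1) inside by blast
    then show "0 \<in> g ` ball 0 r" by simp
    show "g ` cball 0 r \<subseteq> (*) multiplier ` g ` ball 0 r" using sub(2) scaled by blast
  qed (use top in auto)
  \<comment> \<open>The outer boundary of the annulus is again the image of a circle under an
    injective holomorphic map.\<close>
  let ?h = "\<lambda>z. multiplier * g z"
  have h: "?h holomorphic_on ball 0 1" "inj_on ?h (ball 0 1)"
    using g by (auto intro!: holomorphic_intros simp: inj_on_def)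
  have annulus: "annulus = ?h ` ball 0 r - g ` cball 0 r"
    by (simp add: annulus_def image_image)
  have slit_eq: "slit = tate_proj ` g ` sphere 0 r"
    by (simp add: slit_def top(6))
  define \<Gamma>\<^sub>0 where "\<Gamma>\<^sub>0 t = tate_proj (g (of_real r * cis t))" for t
  have \<Gamma>\<^sub>0_image: "curve_image \<Gamma>\<^sub>0 = slit"
    using r by (simp add: curve_image_def \<Gamma>\<^sub>0_def slit_eq circle_image[symmetric] image_image)
  have E_annulus: "E t \<in> annulus" if "t \<in> {0..2 * pi}" for t
  proof -
    have "E t \<in> path_image k" using that E_image by blast
    then show ?thesis
      using scaled[of "E t"] sub(2) inside_no_overlap[of "path_image k"] unfolding annulus_def by blast
  qed
  have \<Gamma>_mem: "\<Gamma> s \<in> torus - slit" for s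
  proof -
    obtain t where "t \<in> {0..2 * pi}" "\<Gamma> s = \<Gamma> t"
      using torus_jordan_curve_mem[OF \<Gamma>, of s] unfolding curve_image_def by blast
    then show ?thesis
      using E_proj E_annulus tate_proj_annulus by (metis imageI)
  qed
  have "torus_jordan_curve \<Gamma>\<^sub>0"
    unfolding torus_jordan_curve_def jordan_curve_def
  proof (intro conjI allI)
    show "curve_image \<Gamma>\<^sub>0 \<subseteq> torus" by (auto simp: \<Gamma>\<^sub>0_image slit_eq)
    show "\<Gamma>\<^sub>0 (t + 2 * pi) = \<Gamma>\<^sub>0 t" for t by (simp add: \<Gamma>\<^sub>0_def cis_mult[symmetric])
    \<comment> \<open>These points lie in the fundamental domain, so the projection is injective on
      the curve and \<open>0\<close> is avoided.\<close>
    have circle: "g (of_real r * cis t) \<in> (*) multiplier ` g ` ball 0 r - g ` ball 0 r" for t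
    proof -
      have "of_real r * cis t \<in> sphere 0 r"
        using r by (simp add: norm_mult)
      then show ?thesis unfolding annulus_Un top(6) by blast
    qed
    have "inj_on (tate_proj \<circ> (g \<circ> (\<lambda>t. of_real r * cis t))) {0..<2 * pi}"
    proof (intro comp_inj_on inj_on_circle)
      show "inj_on g ((\<lambda>t. of_real r * cis t) ` {0..<2 * pi})"
        using r by (intro inj_on_subset[OF g(2)]) (auto simp: norm_mult)
      show "inj_on tate_proj ((g \<circ> (\<lambda>t. of_real r * cis t)) ` {0..<2 * pi})"
        using circle by (intro inj_on_subset[OF inj_on_tate_proj]) auto
    qed (use r in simp)
    then show "inj_on \<Gamma>\<^sub>0 {0..<2 * pi}" by (simp add: \<Gamma>\<^sub>0_def o_def inj_on_def)
    let ?f = "\<lambda>z. g (of_real r * exp (\<i> * z))"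
    let ?S = "{z. cmod (of_real r * exp (\<i> * z)) < 1}"
    note hol = holomorphic_on_circle[OF g(1), of r]
    \<comment> \<open>\<open>smooth_on_tate_proj\<close> asks for a nonvanishing function, so the
      zeros of \<open>?f\<close> are removed; none lies on the real axis.\<close>
    have "open {z\<in>?S. ?f z \<noteq> 0}"
      using continuous_open_preimage[OF holomorphic_on_imp_continuous_on[OF hol(2)] hol(1), of "- {0}"]
      by (auto simp: Int_def vimage_def)
    then have "smooth_on (of_real -` {z\<in>?S. ?f z \<noteq> 0}) (\<lambda>t. tate_proj (?f (of_real t)))"
      by (rule smooth_on_tate_proj[OF _ bounded_linear_of_real])
         (auto intro: holomorphic_on_subset[OF hol(2)])
    moreover have "of_real -` {z\<in>?S. ?f z \<noteq> 0} = (UNIV :: real set)"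
      using r nonzero_if_fundamental[OF circle] by (auto simp: norm_mult cis_conv_exp)
    ultimately show "smooth_on UNIV \<Gamma>\<^sub>0"
      by (simp add: \<Gamma>\<^sub>0_def[abs_def] cis_conv_exp)
  qed
  moreover have "curve_image \<Gamma> \<inter> curve_image \<Gamma>\<^sub>0 = {}"
    using \<Gamma>_mem unfolding \<Gamma>\<^sub>0_image by (auto simp: curve_image_def)
  moreover have "jordan_domain (of_complex ` annulus)"
    unfolding jordan_domain_def
  proof (intro conjI exI)
    have "g ` cball 0 r \<subseteq> ?h ` ball 0 r"
      using S_subset by (simp add: image_image)
    note ann = annulus_topology[OF g h r this, folded annulus]
    show "of_complex ` annulus \<noteq> {}" using E_annulus[of 0] by auto
    show "open (of_complex ` annulus)"
      unfolding of_complex_image_eq by (rule open_to_complex_vimage[OF ann(1)])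
    show "connected (of_complex ` annulus)"
      by (intro connected_continuous_image ann linear_continuous_on bounded_linear_of_complex)
    show "bounded (of_complex ` annulus)"
      by (intro bounded_linear_image ann bounded_linear_of_complex)
    let ?C = "{of_complex ` g ` sphere 0 r, of_complex ` ?h ` sphere 0 r}"
    show "finite ?C" by simp
    show "\<forall>C\<in>?C. \<exists>c. jordan_curve c \<and> C = curve_image c"
      using jordan_curve_disc_circle[OF g r] jordan_curve_disc_circle[OF h r] by blast
    show "frontier (of_complex ` annulus) = \<Union> ?C"
      by (simp add: frontier_of_complex_image ann(4) image_Un)
    \<comment> \<open>The inner boundary lies in the open outer disc image, which the outer boundary
      misses.\<close>
    have "?h ` sphere 0 r \<inter> ?h ` ball 0 r = {}"
      using disc_image_topology(6)[OF h r] by blast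
    then have "g ` sphere 0 r \<inter> ?h ` sphere 0 r = {}"
      using S_subset sphere_cball[of 0 r] unfolding image_image by blast
    then have "of_complex ` g ` sphere 0 r \<inter> of_complex ` ?h ` sphere 0 r = {}"
      by auto
    then show "pairwise disjnt ?C"
      by (auto simp: pairwise_insert disjnt_def)
  qed
  moreover have "torus_diffeo (torus - curve_image \<Gamma>\<^sub>0) (of_complex ` annulus) chart"
    unfolding \<Gamma>\<^sub>0_image by (rule torus_diffeo_chart)
  moreover have "field_index (push_field (torus - curve_image \<Gamma>\<^sub>0) chart (constant_field a b)) (chart \<circ> \<Gamma>) = 1"
    unfolding \<Gamma>\<^sub>0_image
  proof (rule field_index_chart[OF \<Gamma>_mem _ \<gamma>(1,2) _ _ ab])
    have "Ck_on (Suc 0) UNIV \<Gamma>"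
      using \<Gamma> unfolding torus_jordan_curve_def jordan_curve_def smooth_on_def by blast
    then show "\<Gamma> differentiable (at t)" for t by simp
    show "exp (rate * \<gamma> t) \<in> annulus" if "t \<in> {0..2 * pi}" for t
      using E_annulus[OF that] by (simp add: E_def)
    show "\<gamma> (2 * pi) - \<gamma> 0 = of_real (2 * pi) * period"
      using \<gamma>(3) d by simp
  qed
  ultimately show ?thesis by blast
qed

end

section \<open>Reduction to the primitive class underlying the type\<close>

theorem theorem2p5:
  fixes \<Gamma> :: "real \<Rightarrow> complex \<times> complex" and p q :: int and a b :: real
  assumes "torus_jordan_curve \<Gamma>"
    and "has_type \<Gamma> p q"
    and "(p, q) \<noteq> (0, 0)"
    and "(a, b) \<noteq> (0, 0)"
  shows "\<exists>\<Gamma>\<^sub>0 D \<phi>.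
    torus_jordan_curve \<Gamma>\<^sub>0 \<and>
    curve_image \<Gamma> \<inter> curve_image \<Gamma>\<^sub>0 = {} \<and>
    jordan_domain D \<and>
    torus_diffeo (torus - curve_image \<Gamma>\<^sub>0) D \<phi> \<and>
    field_index (push_field (torus - curve_image \<Gamma>\<^sub>0) \<phi> (constant_field a b)) (\<phi> \<circ> \<Gamma>) = 1"
proof -
  obtain \<gamma> where \<gamma>: "continuous_on {0..2 * pi} \<gamma>" "\<And>t. t \<in> {0..2 * pi} \<Longrightarrow> torus_pt (\<gamma> t) = \<Gamma> t"
    "\<gamma> (2 * pi) - \<gamma> 0 = (2 * pi) *\<^sub>R vector [of_int p, of_int q]"
    using assms(2) unfolding has_type_def by blast
  \<comment> \<open>Splitting off the gcd leaves a primitive lattice vector for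
    \<open>period\<close>; that \<open>d\<close> equals \<open>1\<close> emerges only later, from
    the injectivity of the curve.\<close>
  define d where "d = gcd p q"
  have d: "d > 0" using assms(3) by (auto simp: d_def gcd_pos_int)
  then obtain p' q' where pq: "p = d * p'" "q = d * q'" "coprime p' q'"
    unfolding d_def by (metis gcd_coprime_exists less_irrefl mult.commute)
  \<comment> \<open>Bezout coefficients supply the complementary basis vector
    \<open>(v, - u)\<close>, with signs that make the determinant \<open>-1\<close>.\<close>
  then obtain u v where "u * p' + v * q' = 1"
    using bezout_int[of p' q'] by (metis coprime_imp_gcd_eq_1)
  then interpret torus_cover p' q' v "- u"
    by unfold_locales (simp add: algebra_simps)
  show ?thesis
  proof (rule exists_index_one[OF assms(1) _ _ _ d assms(4)])
    show "continuous_on {0..2 * pi} (\<lambda>t. to_complex (\<gamma> t))"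
      by (rule bounded_linear.continuous_on[OF bounded_linear_to_complex \<gamma>(1)])
    show "torus_proj (to_complex (\<gamma> t)) = \<Gamma> t" if "t \<in> {0..2 * pi}" for t
      using \<gamma>(2)[OF that] by (simp add: torus_pt_eq_torus_proj)
    have "to_complex (\<gamma> (2 * pi)) - to_complex (\<gamma> 0) = to_complex (\<gamma> (2 * pi) - \<gamma> 0)"
      by (simp add: to_complex_def complex_eq_iff)
    then show "to_complex (\<gamma> (2 * pi)) - to_complex (\<gamma> 0) = of_real (2 * pi) * of_int d * period"
      unfolding \<gamma>(3) by (simp add: to_complex_def period_def pq complex_eq_iff)
  qed
qed

end
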